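(* Let $s\in(0,1)$, $\alpha\in(0,1)$, $\Omega=(-1,1)\times\mathbb{R}\subset\mathbb{R}^2$, and let $v:\mathbb{R}\to\mathbb{R}$ be a $C^{1,\alpha}$-function such that $\operatorname{subgraph}(v)$ has finite $s$-perimeter in $\Omega$ (i.e. in every bounded Lipschitz subset of $\Omega$). Then there exists an almost minimal set $E$ in $\Omega$ (that is, a set which is $\Lambda$-minimal in $\Omega$ for some $\Lambda\ge0$) such that $E=\operatorname{subgraph}(u)$ for some $u:\mathbb{R}\to\mathbb{R}$ with $u\in C^{1,\alpha}((-1,1))$, $u=v$ on $\mathbb{R}\setminus(-1,1)$, and $u$ discontinuous at the points $-1$ and $1$.
   Context: All sets are Lebesgue measurable. $\operatorname{subgraph}(u)=\{(x_1,x_2)\in\mathbb{R}^2:x_2<u(x_1)\}$. For disjoint $A,B\subseteq\mathbb{R}^2$, $\mathcal{L}(A,B):=\int_A\int_B\frac{dx\,dy}{|x-y|^{2+s}}$; $\operatorname{Per}_s(E,K):=\mathcal{L}(E\cap K,E^c)+\mathcal{L}(E\cap K^c,E^c\cap K)$. For a bounded open Lipschitz set $K$ and $\Lambda\ge0$, $E$ is $\Lambda$-minimal in $K$ if $\operatorname{Per}_s(E,K)<+\infty$ and $\operatorname{Per}_s(E,K)\le\operatorname{Per}_s(F,K)+\Lambda|E\Delta F|$ for every $F$ with $E\Delta F\subseteq K$. Since $\Omega$ is unbounded, $E$ is $\Lambda$-minimal in $\Omega$ if it is $\Lambda$-minimal in every bounded Lipschitz set $K\subseteq\Omega$. *)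

theory Defs
  imports "HOL-Analysis.Analysis"
begin

definition subgraph :: "(real \<Rightarrow> real) \<Rightarrow> (real \<times> real) set" where
  "subgraph u = {(x1, x2). x2 < u x1}"

definition strip :: "(real \<times> real) set" where
  "strip = {-1<..<1} \<times> UNIV"

(* Only used for disjoint A and B, so the value 0 that the kernel takes on the diagonal
   (by the convention 0 powr a = 0) is irrelevant. *)
definition interaction ::
  "real \<Rightarrow> (real \<times> real) set \<Rightarrow> (real \<times> real) set \<Rightarrow> ennreal" where
  "interaction s A B =
     (\<integral>\<^sup>+x\<in>A. (\<integral>\<^sup>+y\<in>B. ennreal (1 / norm (x - y) powr (2 + s)) \<partial>lebesgue) \<partial>lebesgue)"

definition Per ::
  "real \<Rightarrow> (real \<times> real) set \<Rightarrow> (real \<times> real) set \<Rightarrow> ennreal" where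
  "Per s E K = interaction s (E \<inter> K) (- E) + interaction s (E \<inter> - K) (- E \<inter> K)"

(* Near each boundary point p, in a suitable orthonormal frame (a, b) centred at p,
   K is the region below the graph of a Lipschitz function. *)
definition lipschitz_set :: "(real \<times> real) set \<Rightarrow> bool" where
  "lipschitz_set K \<longleftrightarrow>
     (\<forall>p\<in>frontier K. \<exists>a b r L g.
        norm a = 1 \<and> norm b = 1 \<and> a \<bullet> b = 0 \<and> r > 0 \<and>
        L-lipschitz_on UNIV (g :: real \<Rightarrow> real) \<and>
        (\<forall>x\<in>ball p r. x \<in> K \<longleftrightarrow> (x - p) \<bullet> b < g ((x - p) \<bullet> a)))"

definition bounded_lipschitz_open :: "(real \<times> real) set \<Rightarrow> bool" where
  "bounded_lipschitz_open K \<longleftrightarrow> open K \<and> bounded K \<and> lipschitz_set K"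

definition finite_perimeter_in ::
  "real \<Rightarrow> (real \<times> real) set \<Rightarrow> (real \<times> real) set \<Rightarrow> bool" where
  "finite_perimeter_in s E \<Omega> \<longleftrightarrow>
     E \<in> sets lebesgue \<and>
     (\<forall>K. bounded_lipschitz_open K \<and> K \<subseteq> \<Omega> \<longrightarrow> Per s E K < \<infinity>)"

definition minimal_in_bounded ::
  "real \<Rightarrow> real \<Rightarrow> (real \<times> real) set \<Rightarrow> (real \<times> real) set \<Rightarrow> bool" where
  "minimal_in_bounded s \<Lambda> E K \<longleftrightarrow>
     E \<in> sets lebesgue \<and> Per s E K < \<infinity> \<and>
     (\<forall>F\<in>sets lebesgue. sym_diff E F \<subseteq> K \<longrightarrow>
        Per s E K \<le> Per s F K + ennreal \<Lambda> * emeasure lebesgue (sym_diff E F))"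

(* For unbounded \<Omega>: the same \<Lambda> serves all bounded Lipschitz subsets K. *)
definition minimal_in ::
  "real \<Rightarrow> real \<Rightarrow> (real \<times> real) set \<Rightarrow> (real \<times> real) set \<Rightarrow> bool" where
  "minimal_in s \<Lambda> E \<Omega> \<longleftrightarrow>
     (\<forall>K. bounded_lipschitz_open K \<and> K \<subseteq> \<Omega> \<longrightarrow> minimal_in_bounded s \<Lambda> E K)"

definition almost_minimal_in ::
  "real \<Rightarrow> (real \<times> real) set \<Rightarrow> (real \<times> real) set \<Rightarrow> bool" where
  "almost_minimal_in s E \<Omega> \<longleftrightarrow> (\<exists>\<Lambda>\<ge>0. minimal_in s \<Lambda> E \<Omega>)"

(* For an open set U, C^{1,\<alpha>}(U) is read locally: the derivative is \<alpha>-Hoelder on compact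
   subsets of U, with no uniformity up to the boundary of U. *)
definition C1_holder_on :: "real \<Rightarrow> real set \<Rightarrow> (real \<Rightarrow> real) \<Rightarrow> bool" where
  "C1_holder_on \<alpha> U f \<longleftrightarrow>
     (\<exists>f'. (\<forall>x\<in>U. (f has_real_derivative f' x) (at x)) \<and>
       (\<forall>C. compact C \<and> C \<subseteq> U \<longrightarrow>
         (\<exists>M. \<forall>x\<in>C. \<forall>y\<in>C. \<bar>f' x - f' y\<bar> \<le> M * \<bar>x - y\<bar> powr \<alpha>)))"

end

theory Submission
  imports Defs
begin

text \<open>Inside the strip take \<open>u x = h + sqrt (1 - x^2)\<close> with \<open>h\<close> at least \<open>v + 1\<close> on \<open>[-2, 2]\<close>. The
  subgraph of \<open>u\<close> then leaves the walls of the strip tangentially, along unit circular arcs, and \<open>u\<close>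
  jumps at \<open>-1\<close> and \<open>1\<close>. The vertical translates of the arc foliate the strip. Every translate of the
  half-stadium below the arc is convex and has an interior tangent unit disk at each point of the arc,
  so its fractional mean curvature is bounded uniformly: from above by comparison with the disk, from
  below by convexity. The exterior data \<open>v\<close> only matter at distance at least \<open>1\<close> when mass is
  added, and help when mass is removed. A calibration by this foliation yields \<open>\<Lambda>\<close>-minimality; it is
  carried out for truncated kernels, where all quantities are finite, and the truncation is then
  removed by monotone convergence. Comparison with the set emptied inside a large box shows that the
  perimeter is finite.\<close>

section \<open>Interaction energies\<close>

text \<open>The competitors are only Lebesgue measurable, so Tonelli is needed for the completed
  measure. Completion does not change the measure of the Borel sets that exhaust the space.\<close>

lemma sigma_finite_lebesgue:
  "sigma_finite_measure (lebesgue :: 'a::euclidean_space measure)"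
proof
  obtain A :: "'a set set" where A: "countable A" "A \<subseteq> sets lborel" "\<Union>A = space lborel"
    "\<forall>a\<in>A. emeasure lborel a \<noteq> \<infinity>"
    using lborel.sigma_finite_countable by blast
  show "\<exists>A. countable A \<and> A \<subseteq> sets lebesgue \<and> \<Union>A = space (lebesgue :: 'a measure) \<and>
      (\<forall>a\<in>A. emeasure lebesgue a \<noteq> \<infinity>)"
    using A by (intro exI[of _ A]) (auto simp: emeasure_completion main_part_sets)
qed

interpretation lebesgue: sigma_finite_measure "lebesgue :: 'a::euclidean_space measure"
  by (rule sigma_finite_lebesgue)

interpretation lebesgue_pair: pair_sigma_finite
  "lebesgue :: 'a::euclidean_space measure" "lebesgue :: 'b::euclidean_space measure" ..

text \<open>The kernel is a parameter so that the calibration can run on truncated kernels before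
  \<open>interaction\<close> is recovered in the limit.\<close>

definition energy :: "('a::euclidean_space \<Rightarrow> 'a \<Rightarrow> ennreal) \<Rightarrow> 'a set \<Rightarrow> 'a set \<Rightarrow> ennreal" where
  "energy \<kappa> A B = (\<integral>\<^sup>+x\<in>A. (\<integral>\<^sup>+y\<in>B. \<kappa> x y \<partial>lebesgue) \<partial>lebesgue)"

lemma energy_mono:
  assumes "\<And>x y. \<kappa> x y \<le> \<kappa>' x y" "A \<subseteq> A'" "B \<subseteq> B'"
  shows "energy \<kappa> A B \<le> energy \<kappa>' A' B'"
  unfolding energy_def using assms
  by (intro nn_integral_mono mult_mono) (auto split: split_indicator)

text \<open>Both projections remain measurable into the Borel sets, so the product of the completed
  sigma-algebras contains every Borel set of the product.\<close>

lemma pair_measurable_lebesgue: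
  assumes "(\<lambda>(x, y). \<kappa> x y) \<in> borel_measurable borel"
  shows "(\<lambda>(x, y). \<kappa> x y) \<in> borel_measurable ((lebesgue :: 'a::euclidean_space measure) \<Otimes>\<^sub>M (lebesgue :: 'b::euclidean_space measure))"
proof -
  have "(\<lambda>z. z) \<in> (lebesgue :: 'a measure) \<Otimes>\<^sub>M (lebesgue :: 'b measure) \<rightarrow>\<^sub>M borel \<Otimes>\<^sub>M borel"
    by (rule measurable_pair)
       (use measurable_compose[OF measurable_fst id_borel_measurable_lebesgue]
          measurable_compose[OF measurable_snd id_borel_measurable_lebesgue] in \<open>auto simp: comp_def\<close>)
  then show ?thesis
    using assms measurable_compose unfolding borel_prod by blast
qed

context
  fixes \<kappa> :: "'a::euclidean_space \<Rightarrow> 'a \<Rightarrow> ennreal"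
  assumes \<kappa>[measurable]: "(\<lambda>(x, y). \<kappa> x y) \<in> borel_measurable (lebesgue \<Otimes>\<^sub>M lebesgue)"
begin

lemma energy_Un_right:
  assumes [measurable]: "A \<in> sets lebesgue" "B \<in> sets lebesgue" "C \<in> sets lebesgue" and "B \<inter> C = {}"
  shows "energy \<kappa> A (B \<union> C) = energy \<kappa> A B + energy \<kappa> A C"
proof -
  have "(\<integral>\<^sup>+y\<in>B \<union> C. \<kappa> x y \<partial>lebesgue) = (\<integral>\<^sup>+y\<in>B. \<kappa> x y \<partial>lebesgue) + (\<integral>\<^sup>+y\<in>C. \<kappa> x y \<partial>lebesgue)" for x
    using \<open>B \<inter> C = {}\<close>
    by (subst nn_integral_add[symmetric])
       (auto intro!: nn_integral_cong simp: distrib_left[symmetric] split: split_indicator)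
  then show ?thesis
    unfolding energy_def by (simp add: distrib_right nn_integral_add)
qed

lemma energy_commute:
  assumes [measurable]: "A \<in> sets lebesgue" "B \<in> sets lebesgue" and sym: "\<And>x y. \<kappa> x y = \<kappa> y x"
  shows "energy \<kappa> A B = energy \<kappa> B A"
proof -
  have "energy \<kappa> A B = (\<integral>\<^sup>+x. \<integral>\<^sup>+y. \<kappa> x y * indicator B y * indicator A x \<partial>lebesgue \<partial>lebesgue)"
    unfolding energy_def by (simp add: nn_integral_multc)
  also have "\<dots> = (\<integral>\<^sup>+y. \<integral>\<^sup>+x. \<kappa> x y * indicator B y * indicator A x \<partial>lebesgue \<partial>lebesgue)"
    by (rule lebesgue_pair.Fubini'[symmetric]) simp
  also have "\<dots> = energy \<kappa> B A"
    unfolding energy_def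
    by (subst nn_integral_multc[symmetric], simp) (auto intro!: nn_integral_cong simp: sym mult_ac)
  finally show ?thesis .
qed

text \<open>Calibration: \<open>W\<close> consists of the pairs \<open>(x, y)\<close> with \<open>y\<close> on or outside the level set through
  \<open>x\<close>, so \<open>le\<close> bounds the (truncated) fractional mean curvature of that level set from above. By symmetry,
  the part of \<open>le\<close> that comes from pairs inside \<open>A\<close> cancels after integration over \<open>A\<close>.\<close>

lemma energy_compl_le:
  assumes sym: "\<And>x y. \<kappa> x y = \<kappa> y x"
    and [measurable]: "A \<in> sets lebesgue" "E \<in> sets lebesgue" "W \<in> sets (lebesgue \<Otimes>\<^sub>M lebesgue)"
    and "A \<subseteq> E" "emeasure lebesgue A < \<infinity>" "C < \<infinity>" "\<And>x. (\<integral>\<^sup>+y. \<kappa> x y \<partial>lebesgue) \<le> C"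
    and compl: "\<And>x y. x \<in> A \<Longrightarrow> y \<notin> E \<Longrightarrow> (x, y) \<in> W"
    and total: "\<And>x y. x \<in> A \<Longrightarrow> y \<in> A \<Longrightarrow> (x, y) \<notin> W \<Longrightarrow> (y, x) \<in> W"
    and le: "\<And>x. x \<in> A \<Longrightarrow> (\<integral>\<^sup>+y. \<kappa> x y * indicator W (x, y) \<partial>lebesgue)
        \<le> (\<integral>\<^sup>+y. \<kappa> x y * indicator (- W) (x, y) \<partial>lebesgue) + \<Lambda>"
  shows "energy \<kappa> A (- E) \<le> energy \<kappa> A (E - A) + \<Lambda> * emeasure lebesgue A"
proof -
  define J where "J S = (\<integral>\<^sup>+x\<in>A. (\<integral>\<^sup>+y. \<kappa> x y * indicator S (x, y) \<partial>lebesgue) \<partial>lebesgue)" for S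
  \<comment> \<open>Since \<open>J\<close> already restricts \<open>x\<close> to \<open>A\<close>,
    intersecting with \<open>N\<close> isolates the pairs inside \<open>A\<close>, where the
    cancellation takes place.\<close>
  define N where "N = (UNIV :: 'a set) \<times> A"
  have [measurable]: "N \<in> sets (lebesgue \<Otimes>\<^sub>M lebesgue)"
    unfolding N_def by (intro pair_measureI) auto
  have [measurable]: "- S \<in> sets (lebesgue \<Otimes>\<^sub>M lebesgue)" if "S \<in> sets (lebesgue \<Otimes>\<^sub>M lebesgue)" for S :: "('a \<times> 'a) set"
    using sets.compl_sets[OF that] by (simp add: space_pair_measure Compl_eq_Diff_UNIV)
  have split: "J S = J (S \<inter> N) + J (S - N)" if [measurable]: "S \<in> sets (lebesgue \<Otimes>\<^sub>M lebesgue)" for S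
  proof -
    have "(\<integral>\<^sup>+y. \<kappa> x y * indicator S (x, y) \<partial>lebesgue) =
        (\<integral>\<^sup>+y. \<kappa> x y * indicator (S \<inter> N) (x, y) \<partial>lebesgue) + (\<integral>\<^sup>+y. \<kappa> x y * indicator (S - N) (x, y) \<partial>lebesgue)" for x
      by (subst nn_integral_add[symmetric]) (auto intro!: nn_integral_cong split: split_indicator)
    then show ?thesis
      unfolding J_def by (simp add: distrib_right nn_integral_add)
  qed
  \<comment> \<open>This term is cancelled below, hence must be finite; this is why the kernel needs
    finite total mass.\<close>
  have "J (W \<inter> N) \<le> (\<integral>\<^sup>+x\<in>A. C \<partial>lebesgue)"
    unfolding J_def
    by (intro nn_integral_mono mult_right_mono order_trans[OF nn_integral_mono assms(8)])
       (auto split: split_indicator)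
  also have "\<dots> < \<infinity>"
    using assms(6,7) by (simp add: nn_integral_cmult ennreal_mult_less_top)
  finally have fin: "J (W \<inter> N) < \<infinity>" .
  \<comment> \<open>Exchanging \<open>x\<close> and \<open>y\<close> preserves the symmetric kernel,
    and by \<open>total\<close> it maps the pairs of \<open>A\<close> outside \<open>W\<close> into
    \<open>W\<close>.\<close>
  have "J (- W \<inter> N) = (\<integral>\<^sup>+x. \<integral>\<^sup>+y. \<kappa> x y * indicator (- W \<inter> N) (x, y) * indicator A x \<partial>lebesgue \<partial>lebesgue)"
    unfolding J_def by (simp add: nn_integral_multc)
  also have "\<dots> = (\<integral>\<^sup>+y. \<integral>\<^sup>+x. \<kappa> x y * indicator (- W \<inter> N) (x, y) * indicator A x \<partial>lebesgue \<partial>lebesgue)"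
    by (rule lebesgue_pair.Fubini'[symmetric]) simp
  also have "\<dots> \<le> J (W \<inter> N)"
    unfolding J_def nn_integral_multc[symmetric]
    by (subst nn_integral_multc[symmetric], simp)
       (auto intro!: nn_integral_mono dest: total simp: sym N_def split: split_indicator)
  finally have swap: "J (- W \<inter> N) \<le> J (W \<inter> N)" .
  have "J W \<le> (\<integral>\<^sup>+x. (\<integral>\<^sup>+y. \<kappa> x y * indicator (- W) (x, y) \<partial>lebesgue) * indicator A x + \<Lambda> * indicator A x \<partial>lebesgue)"
    unfolding J_def using le by (intro nn_integral_mono) (auto split: split_indicator)
  also have "\<dots> = J (- W) + \<Lambda> * emeasure lebesgue A"
    unfolding J_def by (subst nn_integral_add) (auto simp: nn_integral_cmult)
  finally have "J (W \<inter> N) + J (W - N) \<le> J (- W \<inter> N) + J (- W - N) + \<Lambda> * emeasure lebesgue A"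
    by (simp add: split[of W] split[of "- W"])
  also have "\<dots> \<le> J (W \<inter> N) + (J (- W - N) + \<Lambda> * emeasure lebesgue A)"
    using swap by (simp add: add.assoc add_right_mono)
  finally have "J (W - N) \<le> J (- W - N) + \<Lambda> * emeasure lebesgue A"
    using fin by (auto simp: ennreal_add_left_cancel_le)
  moreover have "energy \<kappa> A (- E) \<le> J (W - N)"
    unfolding energy_def J_def using compl \<open>A \<subseteq> E\<close>
    by (intro nn_integral_mono) (auto intro!: nn_integral_mono simp: N_def split: split_indicator)
  \<comment> \<open>By \<open>compl\<close>, a pair outside \<open>W\<close> that starts in
    \<open>A\<close> must end in \<open>E\<close>.\<close>
  moreover have "J (- W - N) \<le> energy \<kappa> A (E - A)"
    unfolding energy_def J_def using compl
    by (intro nn_integral_mono) (auto intro!: nn_integral_mono simp: N_def split: split_indicator)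
  ultimately show ?thesis
    by (meson add_right_mono order_trans)
qed

end

section \<open>The kernel in the plane\<close>

definition riesz :: "real \<Rightarrow> 'a::euclidean_space \<Rightarrow> ennreal" where
  "riesz p z = ennreal (1 / norm z powr p)"

lemma riesz_measurable[measurable]: "riesz p \<in> borel_measurable borel"
  unfolding riesz_def by measurable

lemma riesz_minus: "riesz p (- z) = riesz p z" "riesz p (x - y) = riesz p (y - x)"
  by (simp_all add: riesz_def norm_minus_commute)

lemma nn_integral_lborel_affine:
  fixes f :: "'a::euclidean_space \<Rightarrow> ennreal"
  assumes [measurable]: "f \<in> borel_measurable borel" and "c \<noteq> 0"
  shows "(\<integral>\<^sup>+z. f z \<partial>lborel) = ennreal (\<bar>c\<bar> ^ DIM('a)) * (\<integral>\<^sup>+z. f (t + c *\<^sub>R z) \<partial>lborel)"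
  by (subst lborel_affine[OF \<open>c \<noteq> 0\<close>, of t])
     (simp add: nn_integral_density nn_integral_distr nn_integral_cmult)

lemma nn_integral_lborel_shift:
  fixes f :: "'a::euclidean_space \<Rightarrow> ennreal"
  assumes "f \<in> borel_measurable borel"
  shows "(\<integral>\<^sup>+z. f (t + z) \<partial>lborel) = (\<integral>\<^sup>+z. f z \<partial>lborel)"
  using nn_integral_lborel_affine[OF assms, of 1 t] by simp

lemma nn_integral_lborel_reflect:
  fixes f :: "'a::euclidean_space \<Rightarrow> ennreal"
  assumes "f \<in> borel_measurable borel"
  shows "(\<integral>\<^sup>+z. f (- z) \<partial>lborel) = (\<integral>\<^sup>+z. f z \<partial>lborel)"
  using nn_integral_lborel_affine[OF assms, of "-1" 0] by simp

lemma nn_integral_powr_tail_finite: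
  fixes p :: real
  assumes "p > 1"
  shows "(\<integral>\<^sup>+t. ennreal ((1 + \<bar>t\<bar>) powr - p) \<partial>lborel) < \<infinity>"
proof -
  define g where "g t = ennreal ((1 + \<bar>t\<bar>) powr - p)" for t :: real
  have [measurable]: "g \<in> borel_measurable borel" unfolding g_def by measurable
  have "(\<integral>\<^sup>+t. ennreal ((1 + \<bar>t\<bar>) powr - p) * indicator {0..} t \<partial>lborel)
      = ennreal (0 - (1 + 0) powr (1 - p) / (1 - p))"
  proof (rule nn_integral_FTC_atLeast)
    fix x :: real assume "0 \<le> x"
    have "((\<lambda>t. (1 + t) powr (1 - p)) has_real_derivative (1 - p) * (1 + x) powr (1 - p - 1) * 1) (at x)"
      using \<open>0 \<le> x\<close> by (intro DERIV_chain2[OF has_real_derivative_powr]) (auto intro!: derivative_eq_intros)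
    from DERIV_cdivide[OF this, of "1 - p"]
    have "((\<lambda>t. (1 + t) powr (1 - p) / (1 - p)) has_real_derivative (1 + x) powr - p) (at x)"
      using assms by simp
    then show "((\<lambda>t. (1 + t) powr (1 - p) / (1 - p)) has_real_derivative (1 + \<bar>x\<bar>) powr - p) (at x)"
      using \<open>0 \<le> x\<close> by simp
  next
    have "((\<lambda>x. (1 + x) powr (1 - p)) \<longlongrightarrow> 0) at_top"
      using assms by (intro tendsto_neg_powr filterlim_tendsto_add_at_top[OF tendsto_const] filterlim_ident) auto
    then show "((\<lambda>x. (1 + x) powr (1 - p) / (1 - p)) \<longlongrightarrow> 0) at_top"
      by (rule tendsto_divide_zero)
  qed auto
  then have fin: "(\<integral>\<^sup>+t. g t * indicator {0..} t \<partial>lborel) < \<infinity>"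
    by (simp add: g_def)
  have "(\<integral>\<^sup>+t. g t \<partial>lborel) \<le> (\<integral>\<^sup>+t. g t * indicator {0..} t + g (- t) * indicator {0..} (- t) \<partial>lborel)"
    by (intro nn_integral_mono) (auto simp: g_def split: split_indicator)
  also have "\<dots> = (\<integral>\<^sup>+t. g t * indicator {0..} t \<partial>lborel) + (\<integral>\<^sup>+t. g (- t) * indicator {0..} (- t) \<partial>lborel)"
    by (rule nn_integral_add) auto
  also have "(\<integral>\<^sup>+t. g (- t) * indicator {0..} (- t) \<partial>lborel) = (\<integral>\<^sup>+t. g t * indicator {0..} t \<partial>lborel)"
    by (rule nn_integral_lborel_reflect) simp
  finally show ?thesis using fin by (simp add: g_def order.strict_trans1)
qed

text \<open>In place of polar coordinates, the kernel is dominated away from the origin by a product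
  of two integrable functions of one variable, each with half the exponent:
  \<open>2 * p = 2 + s\<close> and \<open>p > 1\<close>.\<close>

lemma riesz_tail_finite:
  assumes "s > 0" "d > 0"
  shows "(\<integral>\<^sup>+z\<in>{z. d \<le> norm z}. riesz (2 + s) (z :: real \<times> real) \<partial>lborel) < \<infinity>"
proof -
  define p where "p = 1 + s / 2"
  define c where "c = (1 + 1 / d) powr (2 + s)"
  define g where "g t = ennreal ((1 + \<bar>t\<bar>) powr - p)" for t :: real
  have [measurable]: "g \<in> borel_measurable borel" unfolding g_def by measurable
  have g: "(\<integral>\<^sup>+t. g t \<partial>lborel) < \<infinity>"
    using nn_integral_powr_tail_finite[of p] assms by (simp add: g_def p_def)
  have le: "riesz (2 + s) (a, b) \<le> ennreal c * (g a * g b)" if "d \<le> norm (a, b)" for a b :: real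
  proof -
    define n where "n = norm (a, b)"
    have n: "d \<le> n" "0 < n" "\<bar>a\<bar> \<le> n" "\<bar>b\<bar> \<le> n"
      using that assms norm_fst_le[of a b] norm_snd_le[of b a] by (auto simp: n_def)
    \<comment> \<open>Replacing the summand 1 by \<open>n / d\<close> in
      \<open>1 + \<bar>a\<bar>\<close> produces the constant \<open>c\<close>.\<close>
    have "1 \<le> n / d" using n assms by simp
    then have *: "1 + \<bar>a\<bar> \<le> (1 + 1 / d) * n" "1 + \<bar>b\<bar> \<le> (1 + 1 / d) * n"
      using n by (auto simp: algebra_simps)
    have "(1 + \<bar>a\<bar>) powr p * (1 + \<bar>b\<bar>) powr p \<le> ((1 + 1 / d) * n) powr p * ((1 + 1 / d) * n) powr p"
      using * assms by (intro mult_mono powr_mono2) (auto simp: p_def)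
    also have "\<dots> = ((1 + 1 / d) * n) powr (2 + s)"
      by (simp add: powr_add[symmetric] p_def)
    also have "\<dots> = c * n powr (2 + s)"
      using n assms by (simp add: powr_mult c_def)
    finally have "1 / n powr (2 + s) \<le> c * ((1 + \<bar>a\<bar>) powr - p * (1 + \<bar>b\<bar>) powr - p)"
      using n by (simp add: powr_minus field_simps)
    then show ?thesis
      by (simp add: riesz_def g_def n_def[symmetric] c_def ennreal_mult[symmetric] ennreal_leI)
  qed
  have "(\<integral>\<^sup>+z\<in>{z. d \<le> norm z}. riesz (2 + s) (z :: real \<times> real) \<partial>lborel)
      \<le> (\<integral>\<^sup>+z. ennreal c * (g (fst z) * g (snd z)) \<partial>lborel)"
    using le by (intro nn_integral_mono) (auto split: split_indicator)
  also have "\<dots> = (\<integral>\<^sup>+a. \<integral>\<^sup>+b. ennreal c * (g a * g b) \<partial>lborel \<partial>lborel)"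
    unfolding lborel_prod[symmetric] by (subst lborel.nn_integral_fst[symmetric]) simp_all
  also have "\<dots> = ennreal c * ((\<integral>\<^sup>+t. g t \<partial>lborel) * (\<integral>\<^sup>+t. g t \<partial>lborel))"
    by (simp add: nn_integral_cmult nn_integral_multc)
  also have "\<dots> < \<infinity>"
    using g by (simp add: ennreal_mult_less_top)
  finally show ?thesis .
qed

text \<open>The substitution \<open>z = d w\<close> gives the Jacobian \<open>d^2\<close> and the
  kernel factor \<open>d powr - (2 + s)\<close>. The resulting power of \<open>d\<close> measures
  the singularity of the interaction near the boundary of a box.\<close>

lemma riesz_tail_scale:
  assumes "d > 0"
  shows "(\<integral>\<^sup>+z\<in>{z. d \<le> norm z}. riesz (2 + s) (z :: real \<times> real) \<partial>lborel)
    = ennreal (d powr - s) * (\<integral>\<^sup>+z\<in>{z. 1 \<le> norm z}. riesz (2 + s) (z :: real \<times> real) \<partial>lborel)"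
proof -
  have "riesz (2 + s) (d *\<^sub>R z) * indicator {z. d \<le> norm z} (d *\<^sub>R z)
      = ennreal (d powr - (2 + s)) * (riesz (2 + s) z * indicator {z. 1 \<le> norm z} z)" for z :: "real \<times> real"
  proof -
    have "1 / norm (d *\<^sub>R z) powr (2 + s) = d powr - (2 + s) * (1 / norm z powr (2 + s))"
      unfolding powr_minus_divide using assms by (simp add: powr_mult)
    moreover have "d \<le> norm (d *\<^sub>R z) \<longleftrightarrow> 1 \<le> norm z"
      using assms by simp
    ultimately show ?thesis
      by (simp add: riesz_def ennreal_mult[symmetric] mult.assoc indicator_def)
  qed
  then have "(\<integral>\<^sup>+z\<in>{z. d \<le> norm z}. riesz (2 + s) (z :: real \<times> real) \<partial>lborel)
    = ennreal (d\<^sup>2) * (ennreal (d powr - (2 + s)) * (\<integral>\<^sup>+z\<in>{z. 1 \<le> norm z}. riesz (2 + s) (z :: real \<times> real) \<partial>lborel))"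
    using assms by (subst nn_integral_lborel_affine[where t=0 and c=d])
      (simp_all add: nn_integral_cmult power2_eq_square)
  also have "\<dots> = ennreal (d\<^sup>2 * d powr - (2 + s)) * (\<integral>\<^sup>+z\<in>{z. 1 \<le> norm z}. riesz (2 + s) (z :: real \<times> real) \<partial>lborel)"
    using assms by (simp add: ennreal_mult mult.assoc)
  also have "d\<^sup>2 = d powr 2"
    using assms by simp
  also have "d powr 2 * d powr - (2 + s) = d powr - s"
    by (simp add: powr_add[symmetric] del: powr_numeral)
  finally show ?thesis .
qed

lemma nn_integral_powr_near_0_finite:
  fixes a c :: real
  assumes "a > -1" "c \<ge> 0"
  shows "(\<integral>\<^sup>+t\<in>{-c..c}. ennreal (\<bar>t\<bar> powr a) \<partial>lborel) < \<infinity>"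
proof -
  define g where "g t = ennreal (\<bar>t\<bar> powr a) * indicator {0..c} t" for t :: real
  have [measurable]: "g \<in> borel_measurable borel" unfolding g_def by measurable
  have "((\<lambda>t. \<bar>t\<bar> powr a) has_integral c powr (a + 1) / (a + 1)) {0..c}"
    by (rule has_integral_eq[OF _ has_integral_powr_from_0]) (use assms in auto)
  from nn_integral_has_integral_lebesgue[OF _ this]
  have "(\<integral>\<^sup>+t. ennreal (indicator {0..c} t * \<bar>t\<bar> powr a) \<partial>lborel) = ennreal (c powr (a + 1) / (a + 1))"
    by simp
  also have "(\<integral>\<^sup>+t. ennreal (indicator {0..c} t * \<bar>t\<bar> powr a) \<partial>lborel) = integral\<^sup>N lborel g"
    by (intro nn_integral_cong) (auto simp: g_def split: split_indicator)
  finally have "integral\<^sup>N lborel g = ennreal (c powr (a + 1) / (a + 1))" .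
  then have fin: "integral\<^sup>N lborel g < \<infinity>" by simp
  have "(\<integral>\<^sup>+t\<in>{-c..c}. ennreal (\<bar>t\<bar> powr a) \<partial>lborel) \<le> (\<integral>\<^sup>+t. g t + g (- t) \<partial>lborel)"
    by (intro nn_integral_mono) (auto simp: g_def split: split_indicator)
  also have "\<dots> = integral\<^sup>N lborel g + integral\<^sup>N lborel g"
    by (subst nn_integral_add) (auto simp: nn_integral_lborel_reflect)
  finally show ?thesis using fin by (simp add: order.strict_trans1)
qed

text \<open>If \<open>p\<close> is the centre of a unit disk with boundary point \<open>x\<close> and \<open>q = x - p\<close>, then every small
  \<open>z\<close> for which both \<open>x + z\<close> and \<open>x - z\<close> lie outside the disk belongs to \<open>near_line q\<close>. This set
  is so thin near the origin that the kernel is integrable over it.\<close>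

definition near_line :: "real \<times> real \<Rightarrow> (real \<times> real) set" where
  "near_line q = {z. 2 * \<bar>z \<bullet> q\<bar> \<le> (norm z)\<^sup>2 \<or> 1 / 2 \<le> norm z}"

lemma near_line_measurable[measurable]: "near_line q \<in> sets borel"
  unfolding near_line_def by measurable

lemma near_line_swap: "(b, a) \<in> near_line (q2, q1) \<longleftrightarrow> (a, b) \<in> near_line (q1, q2)"
  by (simp add: near_line_def norm_Pair add.commute)

text \<open>When \<open>q1\<close> is bounded away from 0, the condition on
  \<open>z \<bullet> q\<close> can be solved for the first coordinate: it is determined by
  \<open>b\<close> up to an error quadratic in \<open>norm (a, b)\<close>, which is itself
  comparable to \<open>b\<close>.\<close>

lemma near_line_slice:
  fixes a b q1 q2 :: real
  assumes q: "q1\<^sup>2 + q2\<^sup>2 = 1" "1 / 2 \<le> q1\<^sup>2"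
    and z: "2 * \<bar>a * q1 + b * q2\<bar> \<le> (norm (a, b))\<^sup>2" "norm (a, b) \<le> 1 / 2"
  shows "norm (a, b) \<le> 4 * \<bar>b\<bar>" "\<bar>a + b * q2 / q1\<bar> \<le> 16 * b\<^sup>2"
proof -
  define n where "n = norm (a, b)"
  have q1: "7 / 10 \<le> \<bar>q1\<bar>" "\<bar>q2\<bar> \<le> \<bar>q1\<bar>"
  proof -
    \<comment> \<open>7/10 is a rational number just below the square root of 1/2.\<close>
    have "(7 / 10)\<^sup>2 \<le> \<bar>q1\<bar>\<^sup>2" using q(2) by (simp add: power_divide)
    then show "7 / 10 \<le> \<bar>q1\<bar>" by (rule power2_le_imp_le) simp
    have "q2\<^sup>2 \<le> q1\<^sup>2" using q by linarith
    then show "\<bar>q2\<bar> \<le> \<bar>q1\<bar>" by (simp add: abs_le_square_iff)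
  qed
  then have "q1 \<noteq> 0" by auto
  have "q1 * (a + b * q2 / q1) = a * q1 + b * q2"
    using \<open>q1 \<noteq> 0\<close> by (simp add: field_simps)
  then have "\<bar>q1\<bar> * \<bar>a + b * q2 / q1\<bar> = \<bar>a * q1 + b * q2\<bar>"
    by (metis abs_mult)
  then have "2 * (\<bar>q1\<bar> * \<bar>a + b * q2 / q1\<bar>) \<le> n\<^sup>2"
    using z(1) by (simp only: n_def)
  moreover have "7 / 10 * \<bar>a + b * q2 / q1\<bar> \<le> \<bar>q1\<bar> * \<bar>a + b * q2 / q1\<bar>"
    using q1 by (intro mult_right_mono) auto
  ultimately have 1: "7 / 5 * \<bar>a + b * q2 / q1\<bar> \<le> n\<^sup>2" by simp
  have "n \<le> 1 / 2" "0 \<le> n" using z by (auto simp: n_def)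
  then have "n\<^sup>2 \<le> n / 2"
    using mult_left_mono[of n "1 / 2" n] by (simp add: power2_eq_square)
  have "\<bar>b * q2 / q1\<bar> \<le> \<bar>b\<bar>"
    using q1 \<open>q1 \<noteq> 0\<close> mult_left_mono[of "\<bar>q2\<bar>" "\<bar>q1\<bar>" "\<bar>b\<bar>"]
    by (simp add: abs_mult divide_le_eq)
  moreover have "\<bar>a\<bar> \<le> \<bar>a + b * q2 / q1\<bar> + \<bar>b * q2 / q1\<bar>" by arith
  \<comment> \<open>The factor 5/14 is 5/7 times 1/2. As it is below 1, the \<open>n\<close> on the
    right can be absorbed in \<open>n \<le> \<bar>a\<bar> + \<bar>b\<bar>\<close>.\<close>
  ultimately have "\<bar>a\<bar> \<le> 5 / 14 * n + \<bar>b\<bar>" using 1 \<open>n\<^sup>2 \<le> n / 2\<close> by argo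
  moreover have "n \<le> \<bar>a\<bar> + \<bar>b\<bar>"
    unfolding n_def using norm_Pair_le[of a b] by simp
  ultimately show "norm (a, b) \<le> 4 * \<bar>b\<bar>" using \<open>0 \<le> n\<close> unfolding n_def[symmetric] by linarith
  then have "n\<^sup>2 \<le> (4 * \<bar>b\<bar>)\<^sup>2" using \<open>0 \<le> n\<close> unfolding n_def[symmetric] by (rule power_mono)
  then have "n\<^sup>2 \<le> 16 * b\<^sup>2" by (simp add: power_mult_distrib)
  then show "\<bar>a + b * q2 / q1\<bar> \<le> 16 * b\<^sup>2" using 1 zero_le_power2[of n] by argo
qed

text \<open>The slice at height \<open>b\<close> lies in an interval of length
  \<open>32 * b^2\<close>, on which the kernel is at most
  \<open>\<bar>b\<bar> powr - (2 + s)\<close>. This leaves a multiple of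
  \<open>\<bar>b\<bar> powr - s\<close>, whatever \<open>q\<close> is; the part with norm at least
  1/2 is a tail.\<close>

lemma near_line_bound_steep:
  assumes "0 < s"
  fixes q1 q2 :: real
  assumes q: "q1\<^sup>2 + q2\<^sup>2 = 1" "1 / 2 \<le> q1\<^sup>2"
  shows "(\<integral>\<^sup>+z\<in>near_line (q1, q2). riesz (2 + s) z \<partial>lborel)
    \<le> (\<integral>\<^sup>+z\<in>{z. 1 / 2 \<le> norm z}. riesz (2 + s) (z :: real \<times> real) \<partial>lborel)
      + 32 * (\<integral>\<^sup>+t\<in>{-1..1}. ennreal (\<bar>t\<bar> powr - s) \<partial>lborel)"
proof -
  define h where "h z = ennreal (\<bar>snd z\<bar> powr - (2 + s)) * indicator {-1..1} (snd z) *
      indicator {z. \<bar>fst z + snd z * q2 / q1\<bar> \<le> 16 * (snd z)\<^sup>2} z"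
    for z :: "real \<times> real"
  have "h \<in> borel_measurable (borel \<Otimes>\<^sub>M borel)"
    unfolding h_def by measurable
  then have [measurable]: "h \<in> borel_measurable borel"
    by (simp add: borel_prod)
  have near: "riesz (2 + s) (a, b) \<le> h (a, b)"
    if z: "2 * \<bar>a * q1 + b * q2\<bar> \<le> (norm (a, b))\<^sup>2" "norm (a, b) \<le> 1 / 2" for a b
  proof (cases "b = 0")
    case True
    \<comment> \<open>At the origin the kernel is 0, by the convention that division by 0 gives
      0.\<close>
    then have "(a, b) = 0" using near_line_slice(1)[OF q z] by (simp add: zero_prod_def)
    then show ?thesis by (simp add: riesz_def)
  next
    case False
    have b: "\<bar>b\<bar> \<le> norm (a, b)" using norm_snd_le[of b a] by simp
    have "1 / norm (a, b) powr (2 + s) \<le> 1 / \<bar>b\<bar> powr (2 + s)"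
      using b False assms(1) by (intro frac_le powr_mono2) auto
    moreover have "\<bar>b\<bar> \<le> 1" using b z by simp
    ultimately show ?thesis
      using near_line_slice(2)[OF q z]
      unfolding riesz_def h_def powr_minus_divide by (simp add: abs_le_iff ennreal_leI)
  qed
  have "(\<integral>\<^sup>+z\<in>near_line (q1, q2). riesz (2 + s) z \<partial>lborel)
      \<le> (\<integral>\<^sup>+z. riesz (2 + s) z * indicator {z. 1 / 2 \<le> norm z} z + h z \<partial>lborel)"
  proof (rule nn_integral_mono)
    fix z
    show "riesz (2 + s) z * indicator (near_line (q1, q2)) z
        \<le> riesz (2 + s) z * indicator {z. 1 / 2 \<le> norm z} z + h z"
      using near[of "fst z" "snd z"] by (cases z) (auto simp: near_line_def split: split_indicator)
  qed
  also have "\<dots> = (\<integral>\<^sup>+z\<in>{z. 1 / 2 \<le> norm z}. riesz (2 + s) (z :: real \<times> real) \<partial>lborel) + integral\<^sup>N lborel h"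
    by (rule nn_integral_add) auto
  also have "integral\<^sup>N lborel h = (\<integral>\<^sup>+b. \<integral>\<^sup>+a. h (a, b) \<partial>lborel \<partial>lborel)"
    using lborel_pair.nn_integral_snd[of h] by (simp add: lborel_prod)
  also have "\<dots> = (\<integral>\<^sup>+b. 32 * (ennreal (\<bar>b\<bar> powr - s) * indicator {-1..1} b) \<partial>lborel)"
  proof (rule nn_integral_cong)
    fix b :: real
    have "indicator {z. \<bar>fst z + snd z * q2 / q1\<bar> \<le> 16 * (snd z)\<^sup>2} (a, b)
        = (indicator {- (b * q2 / q1) - 16 * b\<^sup>2..- (b * q2 / q1) + 16 * b\<^sup>2} a :: ennreal)" for a
      by (auto simp: indicator_def)
    then have "(\<integral>\<^sup>+a. h (a, b) \<partial>lborel) = ennreal (\<bar>b\<bar> powr - (2 + s)) * indicator {-1..1} b * ennreal (32 * b\<^sup>2)"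
      unfolding h_def by (simp add: nn_integral_cmult)
    also have "\<dots> = ennreal (\<bar>b\<bar> powr - (2 + s) * (32 * b\<^sup>2)) * indicator {-1..1} b"
      by (simp add: ennreal_mult mult_ac)
    also have "\<bar>b\<bar> powr - (2 + s) * (32 * b\<^sup>2) = 32 * \<bar>b\<bar> powr - s"
    proof (cases "b = 0")
      case False
      then have "b\<^sup>2 = \<bar>b\<bar> powr 2" by simp
      then have "\<bar>b\<bar> powr - (2 + s) * (32 * b\<^sup>2) = 32 * (\<bar>b\<bar> powr - (2 + s) * \<bar>b\<bar> powr 2)" by simp
      then show ?thesis by (simp add: powr_add[symmetric] del: powr_numeral)
    qed simp
    also have "ennreal (32 * \<bar>b\<bar> powr - s) * indicator {-1..1} b = 32 * (ennreal (\<bar>b\<bar> powr - s) * indicator {-1..1} b)"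
      by (simp add: ennreal_mult mult_ac)
    finally show "(\<integral>\<^sup>+a. h (a, b) \<partial>lborel) = 32 * (ennreal (\<bar>b\<bar> powr - s) * indicator {-1..1} b)" .
  qed
  also have "\<dots> = 32 * (\<integral>\<^sup>+t\<in>{-1..1}. ennreal (\<bar>t\<bar> powr - s) \<partial>lborel)"
    by (rule nn_integral_cmult) simp
  finally show ?thesis .
qed

text \<open>One of the squared coordinates of a unit vector is at least 1/2, and the two cases
  differ by a swap of coordinates. The hypothesis \<open>s < 1\<close> makes
  \<open>\<bar>t\<bar> powr - s\<close> integrable at 0. The bound is uniform in \<open>q\<close>
  and ends up as the constant \<Lambda>.\<close>

lemma near_line_bound:
  assumes "0 < s" "s < 1"
  obtains C :: ennreal where "C < \<infinity>"
    "\<And>q. norm q = 1 \<Longrightarrow> (\<integral>\<^sup>+z\<in>near_line q. riesz (2 + s) z \<partial>lborel) \<le> C"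
proof
  define C where "C = (\<integral>\<^sup>+z\<in>{z. 1 / 2 \<le> norm z}. riesz (2 + s) (z :: real \<times> real) \<partial>lborel)
      + 32 * (\<integral>\<^sup>+t\<in>{-1..1}. ennreal (\<bar>t\<bar> powr - s) \<partial>lborel)"
  show "C < \<infinity>"
    using riesz_tail_finite[of s "1 / 2"] nn_integral_powr_near_0_finite[of "- s" 1] assms
    by (simp add: C_def ennreal_mult_less_top)
  fix q :: "real \<times> real" assume "norm q = 1"
  obtain q1 q2 where q12: "q = (q1, q2)" by (cases q)
  have q: "q1\<^sup>2 + q2\<^sup>2 = 1"
    using \<open>norm q = 1\<close> by (simp add: q12 norm_Pair)
  show "(\<integral>\<^sup>+z\<in>near_line q. riesz (2 + s) z \<partial>lborel) \<le> C"
  proof (cases "1 / 2 \<le> q1\<^sup>2")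
    case True
    show ?thesis
      unfolding q12 C_def by (rule near_line_bound_steep[OF \<open>0 < s\<close> q True])
  next
    case False
    then have q': "q2\<^sup>2 + q1\<^sup>2 = 1" "1 / 2 \<le> q2\<^sup>2" using q by linarith+
    define f where "f z = riesz (2 + s) z * indicator (near_line q) z" for z
    have [measurable]: "f \<in> borel_measurable borel" unfolding f_def by measurable
    have "(\<integral>\<^sup>+z. f z \<partial>lborel) = (\<integral>\<^sup>+b. \<integral>\<^sup>+a. f (a, b) \<partial>lborel \<partial>lborel)"
      using lborel_pair.nn_integral_snd[of f] by (simp add: lborel_prod)
    also have "\<dots> = (\<integral>\<^sup>+b. \<integral>\<^sup>+a. riesz (2 + s) (b, a) * indicator (near_line (q2, q1)) (b, a) \<partial>lborel \<partial>lborel)"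
    proof (intro nn_integral_cong)
      fix a b :: real
      have "norm (a, b) = norm (b, a)" by (simp add: norm_Pair add.commute)
      then show "f (a, b) = riesz (2 + s) (b, a) * indicator (near_line (q2, q1)) (b, a)"
        using near_line_swap[of b a q2 q1] by (simp only: f_def riesz_def indicator_def q12)
    qed
    also have "\<dots> = (\<integral>\<^sup>+z\<in>near_line (q2, q1). riesz (2 + s) z \<partial>lborel)"
      using lborel.nn_integral_fst[of "\<lambda>z. riesz (2 + s) z * indicator (near_line (q2, q1)) z" lborel]
      by (simp add: lborel_prod)
    also have "\<dots> \<le> C"
      unfolding C_def by (rule near_line_bound_steep[OF \<open>0 < s\<close> q'])
    finally show ?thesis by (simp add: f_def)
  qed
qed

section \<open>Removing the truncation\<close>

text \<open>Cutting off the singularity gives finite total mass in the plane for exponents above 2,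
  as \<open>energy_compl_le\<close> demands.\<close>

definition riesz_trunc :: "real \<Rightarrow> nat \<Rightarrow> 'a::euclidean_space \<Rightarrow> ennreal" where
  "riesz_trunc p n z = riesz p z * indicator {z. 1 / real (Suc n) \<le> norm z} z"

lemma riesz_trunc_measurable[measurable]: "riesz_trunc p n \<in> borel_measurable borel"
  unfolding riesz_trunc_def by measurable

lemma riesz_trunc_minus: "riesz_trunc p n (- z) = riesz_trunc p n z"
  by (simp add: riesz_trunc_def riesz_minus indicator_def)

lemma riesz_trunc_le: "riesz_trunc p n z \<le> riesz p z"
  by (simp add: riesz_trunc_def indicator_def)

lemma incseq_riesz_trunc: "incseq (\<lambda>n. riesz_trunc p n z)"
proof (rule incseq_SucI)
  fix n
  have "1 / real (Suc (Suc n)) \<le> 1 / real (Suc n)" by (simp add: frac_le)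
  then show "riesz_trunc p n z \<le> riesz_trunc p (Suc n) z"
    by (auto simp: riesz_trunc_def indicator_def)
qed

lemma SUP_riesz_trunc: "(SUP n. riesz_trunc p n z) = riesz p z"
proof (rule antisym)
  show "(SUP n. riesz_trunc p n z) \<le> riesz p z"
    by (intro SUP_least riesz_trunc_le)
  show "riesz p z \<le> (SUP n. riesz_trunc p n z)"
  proof (cases "z = 0")
    case False
    then obtain n where "1 / real (Suc n) < norm z"
      using nat_approx_posE[of "norm z"] by auto
    then have "riesz_trunc p n z = riesz p z"
      by (simp add: riesz_trunc_def indicator_def)
    then show ?thesis by (metis SUP_upper UNIV_I)
  qed (simp add: riesz_def)
qed

lemma kernel_measurable_pair:
  fixes k :: "'a::euclidean_space \<Rightarrow> ennreal"
  assumes [measurable]: "k \<in> borel_measurable borel"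
  shows "(\<lambda>(x, y). k (x - y)) \<in> borel_measurable (lebesgue \<Otimes>\<^sub>M lebesgue)"
proof (rule pair_measurable_lebesgue)
  have "(\<lambda>(x, y). k (x - y)) \<in> borel_measurable (borel \<Otimes>\<^sub>M borel)"
    by measurable
  then show "(\<lambda>(x, y). k (x - y)) \<in> borel_measurable borel"
    by (simp add: borel_prod)
qed

text \<open>Monotone convergence, once in the inner and once in the outer integral. Only the left
  side of an estimate has to pass to the limit, provided \<open>R\<close> is independent of
  \<open>n\<close>.\<close>

lemma energy_riesz_le_trunc:
  fixes A B :: "'a::euclidean_space set"
  assumes [measurable]: "A \<in> sets lebesgue" "B \<in> sets lebesgue"
    and le: "\<And>n. energy (\<lambda>x y. riesz_trunc p n (x - y)) A B \<le> R"
  shows "energy (\<lambda>x y. riesz p (x - y)) A B \<le> R"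
proof -
  note [measurable] = kernel_measurable_pair[OF riesz_trunc_measurable]
  have inner: "(\<integral>\<^sup>+y\<in>B. riesz p (x - y) \<partial>lebesgue) = (SUP n. \<integral>\<^sup>+y\<in>B. riesz_trunc p n (x - y) \<partial>lebesgue)" for x
    using incseq_riesz_trunc unfolding SUP_riesz_trunc[symmetric]
    by (subst nn_integral_monotone_convergence_SUP[symmetric])
       (auto simp: SUP_mult_right_ennreal incseq_def le_fun_def intro!: mult_right_mono)
  have "energy (\<lambda>x y. riesz p (x - y)) A B = (SUP n. energy (\<lambda>x y. riesz_trunc p n (x - y)) A B)"
    unfolding energy_def inner using incseq_riesz_trunc
    by (subst nn_integral_monotone_convergence_SUP[symmetric])
       (auto simp: SUP_mult_right_ennreal incseq_def le_fun_def intro!: mult_right_mono nn_integral_mono)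
  then show ?thesis using le by (simp add: SUP_least)
qed

text \<open>Pairing \<open>x + z\<close> with \<open>x - z\<close> replaces the principal value: only the \<open>z\<close> for which both points
  lie in \<open>W\<close> contribute to the excess.\<close>

lemma kernel_integral_le_reflect:
  fixes k :: "'a::euclidean_space \<Rightarrow> ennreal"
  assumes [measurable]: "k \<in> borel_measurable borel" "W \<in> sets borel" "Z \<in> sets borel"
    and even: "\<And>z. k (- z) = k z" and "k 0 = 0" and fin: "(\<integral>\<^sup>+z. k z \<partial>lborel) < \<infinity>"
    and Z: "\<And>z. z \<noteq> 0 \<Longrightarrow> x + z \<in> W \<Longrightarrow> x - z \<in> W \<Longrightarrow> z \<in> Z"
  shows "(\<integral>\<^sup>+y\<in>W. k (x - y) \<partial>lborel) \<le> (\<integral>\<^sup>+y\<in>- W. k (x - y) \<partial>lborel) + (\<integral>\<^sup>+z\<in>Z. k z \<partial>lborel)"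
proof -
  have shift: "(\<integral>\<^sup>+y\<in>S. k (x - y) \<partial>lborel) = (\<integral>\<^sup>+z. k z * indicator S (x + z) \<partial>lborel)"
    if [measurable]: "S \<in> sets borel" for S
    using nn_integral_lborel_shift[of "\<lambda>y. k (x - y) * indicator S y" x] by (simp add: even)
  have refl: "(\<integral>\<^sup>+z. k z * indicator W (x - z) \<partial>lborel) = (\<integral>\<^sup>+z. k z * indicator W (x + z) \<partial>lborel)"
    using nn_integral_lborel_reflect[of "\<lambda>z. k z * indicator W (x + z)"] by (simp add: even)
  \<comment> \<open>The integral over \<open>W\<close> is written twice, the second time reflected.
    Pointwise, \<open>x - z\<close> in \<open>W\<close> forces \<open>x + z\<close> out of
    \<open>W\<close> unless \<open>z\<close> is in \<open>Z\<close> or zero. One copy is then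
    cancelled, which is legitimate because the total mass is finite.\<close>
  have "(\<integral>\<^sup>+z. k z * indicator W (x + z) \<partial>lborel) + (\<integral>\<^sup>+z. k z * indicator W (x - z) \<partial>lborel)
      = (\<integral>\<^sup>+z. k z * indicator W (x + z) + k z * indicator W (x - z) \<partial>lborel)"
    by (rule nn_integral_add[symmetric]) auto
  also have "\<dots> \<le> (\<integral>\<^sup>+z. k z * indicator W (x + z) + (k z * indicator (- W) (x + z) + k z * indicator Z z) \<partial>lborel)"
  proof (rule nn_integral_mono)
    fix z
    show "k z * indicator W (x + z) + k z * indicator W (x - z)
        \<le> k z * indicator W (x + z) + (k z * indicator (- W) (x + z) + k z * indicator Z z)"
      using Z[of z] \<open>k 0 = 0\<close> by (cases "z = 0") (auto split: split_indicator)
  qed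
  also have "\<dots> = (\<integral>\<^sup>+z. k z * indicator W (x + z) \<partial>lborel) +
      ((\<integral>\<^sup>+z. k z * indicator (- W) (x + z) \<partial>lborel) + (\<integral>\<^sup>+z\<in>Z. k z \<partial>lborel))"
    by (simp add: nn_integral_add)
  finally have "(\<integral>\<^sup>+z. k z * indicator W (x + z) \<partial>lborel)
      \<le> (\<integral>\<^sup>+z. k z * indicator (- W) (x + z) \<partial>lborel) + (\<integral>\<^sup>+z\<in>Z. k z \<partial>lborel)
    \<or> (\<integral>\<^sup>+z. k z * indicator W (x + z) \<partial>lborel) = \<infinity>"
    unfolding refl by (auto simp: ennreal_add_left_cancel_le)
  moreover have "(\<integral>\<^sup>+z. k z * indicator W (x + z) \<partial>lborel) \<le> (\<integral>\<^sup>+z. k z \<partial>lborel)"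
    by (intro nn_integral_mono) (auto split: split_indicator)
  ultimately show ?thesis
    using fin by (auto simp: shift)
qed

text \<open>At each truncation level, \<open>near\<close> and the reflection argument bound the
  curvature excess at \<open>x\<close> by the integral over some \<open>near_line q\<close>, hence
  by \<open>C\<close>. This is the hypothesis \<open>le\<close> of \<open>energy_compl_le\<close>,
  uniformly in \<open>x\<close> and in the level.\<close>

lemma riesz_energy_compl_le:
  fixes A E :: "(real \<times> real) set"
  assumes "0 < s"
    and C: "\<And>q. norm q = 1 \<Longrightarrow> (\<integral>\<^sup>+z\<in>near_line q. riesz (2 + s) z \<partial>lborel) \<le> C"
    and [measurable]: "A \<in> sets lebesgue" "E \<in> sets lebesgue" and W[measurable]: "W \<in> sets borel"
    and "A \<subseteq> E" "emeasure lebesgue A < \<infinity>"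
    and compl: "\<And>x y. x \<in> A \<Longrightarrow> y \<notin> E \<Longrightarrow> (x, y) \<in> W"
    and total: "\<And>x y. x \<in> A \<Longrightarrow> y \<in> A \<Longrightarrow> (x, y) \<notin> W \<Longrightarrow> (y, x) \<in> W"
    and near: "\<And>x. x \<in> A \<Longrightarrow>
      \<exists>q. norm q = 1 \<and> (\<forall>z. z \<noteq> 0 \<longrightarrow> (x, x + z) \<in> W \<longrightarrow> (x, x - z) \<in> W \<longrightarrow> z \<in> near_line q)"
  shows "energy (\<lambda>x y. riesz (2 + s) (x - y)) A (- E)
    \<le> energy (\<lambda>x y. riesz (2 + s) (x - y)) A (E - A) + C * emeasure lebesgue A"
proof (rule energy_riesz_le_trunc)
  fix n
  let ?k = "riesz_trunc (2 + s) n :: real \<times> real \<Rightarrow> ennreal"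
  have fin: "(\<integral>\<^sup>+z. ?k z \<partial>lborel) < \<infinity>"
    using riesz_tail_finite[OF \<open>0 < s\<close>, of "1 / real (Suc n)"] by (simp add: riesz_trunc_def)
  have total_mass: "(\<integral>\<^sup>+y. ?k (x - y) \<partial>lebesgue) = (\<integral>\<^sup>+z. ?k z \<partial>lborel)" for x
    using nn_integral_lborel_shift[of "\<lambda>y. ?k (x - y)" x]
    by (simp add: nn_integral_completion riesz_trunc_minus)
  have W2: "W \<in> sets (lebesgue \<Otimes>\<^sub>M lebesgue)"
  proof -
    have "(\<lambda>(x, y). indicator W (x, y) :: ennreal) \<in> borel_measurable (lebesgue \<Otimes>\<^sub>M lebesgue)"
      by (rule pair_measurable_lebesgue) simp
    then show ?thesis
      by (simp add: borel_measurable_indicator_iff space_pair_measure)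
  qed
  have "energy (\<lambda>x y. ?k (x - y)) A (- E)
      \<le> energy (\<lambda>x y. ?k (x - y)) A (E - A) + C * emeasure lebesgue A"
  proof (rule energy_compl_le[where W = W and C = "\<integral>\<^sup>+z. ?k z \<partial>lborel"])
    show "(\<lambda>(x, y). ?k (x - y)) \<in> borel_measurable (lebesgue \<Otimes>\<^sub>M lebesgue)"
      by (rule kernel_measurable_pair) simp
    show "?k (x - y) = ?k (y - x)" for x y
      using riesz_trunc_minus[of "2 + s" n "x - y"] by simp
  next
    fix x assume "x \<in> A"
    then obtain q where q: "norm q = 1"
      "\<And>z. z \<noteq> 0 \<Longrightarrow> (x, x + z) \<in> W \<Longrightarrow> (x, x - z) \<in> W \<Longrightarrow> z \<in> near_line q"
      using near by blast
    define V where "V = Pair x -` W"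
    have "W \<in> sets (borel \<Otimes>\<^sub>M borel)" by (metis W borel_prod)
    then have [measurable]: "V \<in> sets borel"
      unfolding V_def by (rule sets_Pair1)
    have "(\<integral>\<^sup>+y\<in>V. ?k (x - y) \<partial>lborel) \<le> (\<integral>\<^sup>+y\<in>- V. ?k (x - y) \<partial>lborel) + (\<integral>\<^sup>+z\<in>near_line q. ?k z \<partial>lborel)"
    proof (rule kernel_integral_le_reflect)
      show "?k (- z) = ?k z" for z by (rule riesz_trunc_minus)
      show "?k 0 = 0" by (simp add: riesz_trunc_def riesz_def)
      show "z \<in> near_line q" if "z \<noteq> 0" "x + z \<in> V" "x - z \<in> V" for z
        using q(2)[of z] that by (simp add: V_def)
    qed (use fin in simp_all)
    also have "(\<integral>\<^sup>+z\<in>near_line q. ?k z \<partial>lborel) \<le> (\<integral>\<^sup>+z\<in>near_line q. riesz (2 + s) z \<partial>lborel)"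
      by (intro nn_integral_mono mult_right_mono riesz_trunc_le) auto
    also have "\<dots> \<le> C" by (rule C[OF q(1)])
    finally have "(\<integral>\<^sup>+y\<in>V. ?k (x - y) \<partial>lborel) \<le> (\<integral>\<^sup>+y\<in>- V. ?k (x - y) \<partial>lborel) + C"
      by (simp add: add_left_mono)
    moreover have "indicator V y = (indicator W (x, y) :: ennreal)"
      "indicator (- V) y = (indicator (- W) (x, y) :: ennreal)" for y
      by (simp_all add: V_def indicator_def)
    ultimately show "(\<integral>\<^sup>+y. ?k (x - y) * indicator W (x, y) \<partial>lebesgue)
        \<le> (\<integral>\<^sup>+y. ?k (x - y) * indicator (- W) (x, y) \<partial>lebesgue) + C"
      by (simp only: nn_integral_completion)
  qed (fact assms(3,4,6,7) fin W2 compl total eq_refl[OF total_mass])+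
  \<comment> \<open>Passing to the full kernel on the right removes the dependence on
    \<open>n\<close>.\<close>
  also have "\<dots> \<le> energy (\<lambda>x y. riesz (2 + s) (x - y)) A (E - A) + C * emeasure lebesgue A"
    by (intro add_right_mono energy_mono riesz_trunc_le) auto
  finally show "energy (\<lambda>x y. ?k (x - y)) A (- E)
      \<le> energy (\<lambda>x y. riesz (2 + s) (x - y)) A (E - A) + C * emeasure lebesgue A" .
qed (simp_all add: Compl_in_sets_lebesgue assms(3,4))

section \<open>Rules for interactions and the comparison of perimeters\<close>

lemma interaction_eq_energy: "interaction s A B = energy (\<lambda>x y. riesz (2 + s) (x - y)) A B"
  by (simp add: interaction_def energy_def riesz_def)

lemma interaction_mono: "A \<subseteq> A' \<Longrightarrow> B \<subseteq> B' \<Longrightarrow> interaction s A B \<le> interaction s A' B'"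
  unfolding interaction_eq_energy by (rule energy_mono) auto

lemma interaction_commute:
  "A \<in> sets lebesgue \<Longrightarrow> B \<in> sets lebesgue \<Longrightarrow> interaction s A B = interaction s B A"
  unfolding interaction_eq_energy
  by (rule energy_commute[OF kernel_measurable_pair]) (auto simp: riesz_minus)

lemma interaction_Un_right:
  assumes "A \<in> sets lebesgue" "B \<in> sets lebesgue" "C \<in> sets lebesgue" "B \<inter> C = {}"
  shows "interaction s A (B \<union> C) = interaction s A B + interaction s A C"
  unfolding interaction_eq_energy
  by (rule energy_Un_right[OF kernel_measurable_pair[OF riesz_measurable] assms])

lemma interaction_Un_left:
  assumes "A \<in> sets lebesgue" "B \<in> sets lebesgue" "C \<in> sets lebesgue" "B \<inter> C = {}"
  shows "interaction s (B \<union> C) A = interaction s B A + interaction s C A"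
  using interaction_Un_right[OF assms, of s] interaction_commute[of A _ s] assms by simp

text \<open>Enlarging \<open>K\<close> moves \<open>R\<close> from the outer to the inner part of
  \<open>E\<close>. What \<open>R\<close> contributed before, its interaction with
  \<open>- E \<inter> K\<close>, is contained in its new interaction with all of
  \<open>- E\<close>.\<close>

lemma Per_mono:
  assumes [measurable]: "E \<in> sets lebesgue" "K \<in> sets lebesgue" "K' \<in> sets lebesgue" and "K \<subseteq> K'"
  shows "Per s E K \<le> Per s E K'"
proof -
  define R where "R = E \<inter> (K' - K)"
  have [measurable]: "R \<in> sets lebesgue" "- E \<in> sets lebesgue"
    using assms(1) by (auto simp: R_def Compl_in_sets_lebesgue)
  have eq: "E \<inter> K' = (E \<inter> K) \<union> R" "E \<inter> - K = (E \<inter> - K') \<union> R"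
    using \<open>K \<subseteq> K'\<close> by (auto simp: R_def)
  have "Per s E K = interaction s (E \<inter> K) (- E) +
      (interaction s (E \<inter> - K') (- E \<inter> K) + interaction s R (- E \<inter> K))"
    unfolding Per_def eq(2) by (subst interaction_Un_left) (auto simp: R_def)
  also have "\<dots> \<le> interaction s (E \<inter> K) (- E) +
      (interaction s (E \<inter> - K') (- E \<inter> K') + interaction s R (- E))"
    using \<open>K \<subseteq> K'\<close> by (intro add_mono interaction_mono) auto
  also have "\<dots> = Per s E K'"
    unfolding Per_def eq(1) by (subst interaction_Un_left) (auto simp: R_def ac_simps)
  finally show ?thesis .
qed

text \<open>The plane is cut into the removed part \<open>A\<close>, the added part
  \<open>B\<close>, the common part \<open>G\<close> and the common complement \<open>D\<close>. The
  interactions of \<open>G\<close> with \<open>D\<close> agree in both perimeters and are collected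
  in \<open>Q\<close>, so the rest reduces to one estimate for \<open>A\<close> and one for
  \<open>B\<close>.\<close>

lemma Per_le_if_one_sided:
  assumes [measurable]: "E \<in> sets lebesgue" "F \<in> sets lebesgue" "K \<in> sets lebesgue"
    and K: "sym_diff E F \<subseteq> K"
    and removed: "interaction s (E - F) (- E) \<le> interaction s (E - F) (E \<inter> F) + C * emeasure lebesgue (E - F)"
    and added: "interaction s (F - E) E \<le> interaction s (F - E) (- (E \<union> F)) + C * emeasure lebesgue (F - E)"
  shows "Per s E K \<le> Per s F K + C * emeasure lebesgue (sym_diff E F)"
proof -
  define A B G D where defs: "A = E - F" "B = F - E" "G = E \<inter> F" "D = - (E \<union> F)"
  have [measurable]: "A \<in> sets lebesgue" "B \<in> sets lebesgue" "G \<in> sets lebesgue" "D \<in> sets lebesgue"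
    by (auto simp: defs)
  define Q where "Q = interaction s (G \<inter> K) D + interaction s (G - K) (D \<inter> K)"
  have G: "interaction s G X = interaction s (G \<inter> K) X + interaction s (G - K) X"
    if [measurable]: "X \<in> sets lebesgue" for X
    using interaction_Un_left[of X "G \<inter> K" "G - K" s] Int_Diff_Un[of G K] by auto
  have decE: "E \<inter> K = A \<union> (G \<inter> K)" "- E = B \<union> D" "E \<inter> - K = G - K" "- E \<inter> K = B \<union> (D \<inter> K)"
    using K by (auto simp: defs)
  have "Per s E K = (interaction s A B + interaction s A D + (interaction s (G \<inter> K) B + interaction s (G \<inter> K) D)) +
      (interaction s (G - K) B + interaction s (G - K) (D \<inter> K))"
    unfolding Per_def decE(1,3,4) unfolding decE(2)
    by (subst interaction_Un_left; (auto simp: defs; fail)?)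
       (subst interaction_Un_right; (auto simp: defs; fail)?)+
  then have PE: "Per s E K = interaction s A B + interaction s A D + interaction s G B + Q"
    by (simp add: G Q_def ac_simps)
  have decF: "F \<inter> K = B \<union> (G \<inter> K)" "- F = A \<union> D" "F \<inter> - K = G - K" "- F \<inter> K = A \<union> (D \<inter> K)"
    using K by (auto simp: defs)
  have "Per s F K = (interaction s B A + interaction s B D + (interaction s (G \<inter> K) A + interaction s (G \<inter> K) D)) +
      (interaction s (G - K) A + interaction s (G - K) (D \<inter> K))"
    unfolding Per_def decF(1,3,4) unfolding decF(2)
    by (subst interaction_Un_left; (auto simp: defs; fail)?)
       (subst interaction_Un_right; (auto simp: defs; fail)?)+
  then have PF: "Per s F K = interaction s B A + interaction s B D + interaction s G A + Q"
    by (simp add: G Q_def ac_simps)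
  have "interaction s A (B \<union> D) = interaction s A B + interaction s A D"
    by (rule interaction_Un_right) (auto simp: defs)
  then have 1: "interaction s A B + interaction s A D \<le> interaction s G A + C * emeasure lebesgue A"
    using removed interaction_commute[of A G s] by (simp add: decE(2) flip: defs)
  have "interaction s G B = interaction s B G" by (rule interaction_commute) auto
  also have "\<dots> \<le> interaction s B E" by (rule interaction_mono) (auto simp: defs)
  also have "\<dots> \<le> interaction s B D + C * emeasure lebesgue B" using added by (simp add: defs)
  finally have 2: "interaction s G B \<le> interaction s B D + C * emeasure lebesgue B" .
  have "Per s E K \<le> (interaction s G A + C * emeasure lebesgue A) + (interaction s B D + C * emeasure lebesgue B) + Q"
    unfolding PE by (intro add_mono 1 2 order_refl)
  \<comment> \<open>The estimate for \<open>A\<close> has already paid for its interaction with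
    \<open>B\<close>; the same interaction in \<open>Per s F K\<close> is a nonnegative
    surplus.\<close>
  also have "\<dots> \<le> interaction s B A + \<dots>" by simp
  also have "\<dots> = Per s F K + C * (emeasure lebesgue A + emeasure lebesgue B)"
    unfolding PF by (simp add: distrib_left ac_simps)
  also have "emeasure lebesgue A + emeasure lebesgue B = emeasure lebesgue (sym_diff E F)"
    by (subst plus_emeasure) (auto simp: defs)
  finally show ?thesis .
qed

section \<open>Regularity and the perimeter of a box\<close>

text \<open>On a compact set the derivative is Lipschitz, and on a set of diameter at most
  \<open>D\<close> one has \<open>\<bar>x - y\<bar> \<le> D powr (1 - \<alpha>) * \<bar>x - y\<bar>
  powr \<alpha>\<close>.\<close>

lemma C1_holder_on_if_C2:
  fixes f g h :: "real \<Rightarrow> real"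
  assumes "\<alpha> < 1"
    and f: "\<And>x. x \<in> U \<Longrightarrow> (f has_real_derivative g x) (at x)"
    and g: "\<And>x. x \<in> U \<Longrightarrow> (g has_real_derivative h x) (at x)"
    and "continuous_on U h" and "convex U"
  shows "C1_holder_on \<alpha> U f"
  unfolding C1_holder_on_def
proof (intro exI[of _ g] conjI ballI allI impI f, assumption)
  fix K assume K: "compact K \<and> K \<subseteq> U"
  \<comment> \<open>The mean value inequality needs segments between points of \<open>K\<close>; the
    hull is still compact and inside the convex set \<open>U\<close>.\<close>
  define S where "S = convex hull K"
  have S: "compact S" "S \<subseteq> U" "convex S" "K \<subseteq> S"
    using K \<open>convex U\<close> by (auto simp: S_def compact_convex_hull hull_minimal hull_subset)
  obtain M where M: "\<And>x. x \<in> S \<Longrightarrow> \<bar>h x\<bar> \<le> M" and "M > 0"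
    using compact_imp_bounded[OF compact_continuous_image[OF continuous_on_subset[OF \<open>continuous_on U h\<close> S(2)] S(1)]]
    by (auto simp: bounded_pos)
  obtain D where D: "\<And>x y. x \<in> S \<Longrightarrow> y \<in> S \<Longrightarrow> \<bar>x - y\<bar> \<le> D" and "D > 0"
  proof -
    obtain b where "b > 0" and b: "\<And>x. x \<in> S \<Longrightarrow> \<bar>x\<bar> \<le> b"
      using compact_imp_bounded[OF S(1)] by (auto simp: bounded_pos)
    have "\<bar>x - y\<bar> \<le> 2 * b" if "x \<in> S" "y \<in> S" for x y
      using b[OF that(1)] b[OF that(2)] by linarith
    then show ?thesis using \<open>b > 0\<close> by (intro that[of "2 * b"]) auto
  qed
  show "\<exists>M. \<forall>x\<in>K. \<forall>y\<in>K. \<bar>g x - g y\<bar> \<le> M * \<bar>x - y\<bar> powr \<alpha>"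
  proof (intro exI[of _ "M * D powr (1 - \<alpha>)"] ballI)
    fix x y assume "x \<in> K" "y \<in> K"
    then have xy: "x \<in> S" "y \<in> S" using S by auto
    have "norm (g x - g y) \<le> M * norm (x - y)"
    proof (rule field_differentiable_bound[OF \<open>convex S\<close>])
      show "(g has_field_derivative h t) (at t within S)" if "t \<in> S" for t
        using g \<open>S \<subseteq> U\<close> that by (blast intro: has_field_derivative_at_within)
      show "norm (h t) \<le> M" if "t \<in> S" for t
        using M[OF that] by simp
    qed (fact xy)+
    also have "norm (x - y) \<le> D powr (1 - \<alpha>) * \<bar>x - y\<bar> powr \<alpha>"
    proof (cases "x = y")
      case False
      then have "\<bar>x - y\<bar> = \<bar>x - y\<bar> powr (1 - \<alpha>) * \<bar>x - y\<bar> powr \<alpha>"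
        by (simp add: powr_add[symmetric])
      also have "\<dots> \<le> D powr (1 - \<alpha>) * \<bar>x - y\<bar> powr \<alpha>"
        using D[OF xy] \<open>\<alpha> < 1\<close> by (intro mult_right_mono powr_mono2) auto
      finally show ?thesis by simp
    qed simp
    finally show "\<bar>g x - g y\<bar> \<le> M * D powr (1 - \<alpha>) * \<bar>x - y\<bar> powr \<alpha>"
      using \<open>M > 0\<close> by (simp add: mult_left_mono mult.assoc)
  qed
qed

lemma semicircle_C1_holder:
  assumes "\<alpha> < 1"
  shows "C1_holder_on \<alpha> {-1<..<1} (\<lambda>x. h + sqrt (1 - x\<^sup>2))"
proof (rule C1_holder_on_if_C2[OF assms])
  fix x :: real assume "x \<in> {-1<..<1}"
  then have x: "x\<^sup>2 < 1" by (simp add: abs_square_less_1 abs_less_iff)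
  show "((\<lambda>x. h + sqrt (1 - x\<^sup>2)) has_real_derivative - x / sqrt (1 - x\<^sup>2)) (at x)"
    using x by (auto intro!: derivative_eq_intros simp: field_simps)
  show "((\<lambda>x. - x / sqrt (1 - x\<^sup>2)) has_real_derivative
      (- 1 * sqrt (1 - x\<^sup>2) - - x * (- x / sqrt (1 - x\<^sup>2))) / (sqrt (1 - x\<^sup>2) * sqrt (1 - x\<^sup>2))) (at x)"
    using x by (intro DERIV_divide) (auto intro!: derivative_eq_intros simp: field_simps)
next
  have "x\<^sup>2 \<noteq> 1" if "x \<in> {-1<..<1}" for x :: real
    using that abs_square_less_1[of x] by (auto simp: abs_less_iff)
  then show "continuous_on {-1<..<1} (\<lambda>x::real. (- 1 * sqrt (1 - x\<^sup>2) - - x * (- x / sqrt (1 - x\<^sup>2))) / (sqrt (1 - x\<^sup>2) * sqrt (1 - x\<^sup>2)))"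
    by (intro continuous_intros) auto
qed auto

lemma not_isCont_if_one_sided_limit:
  fixes u w :: "real \<Rightarrow> real"
  assumes "a \<in> closure U" "a \<notin> U" "\<And>x. x \<in> U \<Longrightarrow> u x = w x" "isCont w a" "u a \<noteq> w a"
  shows "\<not> isCont u a"
proof
  assume "isCont u a"
  then have "(u \<longlongrightarrow> u a) (at a within U)"
    by (meson continuous_at_imp_continuous_at_within continuous_within)
  moreover have "(w \<longlongrightarrow> w a) (at a within U)"
    using \<open>isCont w a\<close> by (meson continuous_at_imp_continuous_at_within continuous_within)
  then have "(u \<longlongrightarrow> w a) (at a within U)"
    by (rule Lim_transform_eventually) (auto simp: eventually_at_filter assms(3))
  moreover have "at a within U \<noteq> bot"
    using assms(1,2) by (simp add: trivial_limit_within islimpt_in_closure)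
  ultimately show False using tendsto_unique assms(5) by blast
qed

section \<open>Finite fractional perimeter of a box\<close>

lemma dist_to_ends_powr_finite:
  fixes N s :: real
  assumes "s < 1" "0 \<le> N"
  shows "(\<integral>\<^sup>+t\<in>{-N<..<N}. ennreal ((N - \<bar>t\<bar>) powr - s) \<partial>lborel) < \<infinity>"
proof -
  define g where "g t = ennreal (\<bar>t\<bar> powr - s) * indicator {-(2 * N)..2 * N} t" for t
  have [measurable]: "g \<in> borel_measurable borel" unfolding g_def by measurable
  have fin: "integral\<^sup>N lborel g < \<infinity>"
    unfolding g_def using nn_integral_powr_near_0_finite[of "- s" "2 * N"] assms by simp
  have "(\<integral>\<^sup>+t\<in>{-N<..<N}. ennreal ((N - \<bar>t\<bar>) powr - s) \<partial>lborel) \<le> (\<integral>\<^sup>+t. g (N + t) + g (- N + t) \<partial>lborel)"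
  proof (rule nn_integral_mono)
    fix t
    show "ennreal ((N - \<bar>t\<bar>) powr - s) * indicator {-N<..<N} t \<le> g (N + t) + g (- N + t)"
      by (cases "0 \<le> t") (auto simp: g_def abs_if split: split_indicator)
  qed
  also have "\<dots> = (\<integral>\<^sup>+t. g (N + t) \<partial>lborel) + (\<integral>\<^sup>+t. g (- N + t) \<partial>lborel)"
    by (rule nn_integral_add) auto
  also have "\<dots> = integral\<^sup>N lborel g + integral\<^sup>N lborel g"
    by (simp only: nn_integral_lborel_shift[OF \<open>g \<in> borel_measurable borel\<close>])
  finally show ?thesis using fin by (simp add: order.strict_trans1)
qed

text \<open>A point at distance at least \<open>d\<close> from the complement interacts with it by
  at most \<open>T * d powr - s\<close>. The distance is bounded below by the smaller of the
  horizontal and vertical distances to the sides, so its power is at most the sum of two powers,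
  each depending on one coordinate and integrable for \<open>s < 1\<close>.\<close>

lemma interaction_box_finite:
  assumes "0 < s" "s < 1" "0 \<le> N"
  defines "K \<equiv> {-1<..<1} \<times> {-N<..<N}"
  shows "interaction s K (- K) < \<infinity>"
proof -
  define T where "T = (\<integral>\<^sup>+z\<in>{z. 1 \<le> norm z}. riesz (2 + s) (z :: real \<times> real) \<partial>lborel)"
  define f where "f M t = ennreal ((M - \<bar>t\<bar>) powr - s) * indicator {-M<..<M} t" for M t :: real
  define j where "j M t = (indicator {-M<..<M} t :: ennreal)" for M t :: real
  have [measurable]: "f M \<in> borel_measurable borel" "j M \<in> borel_measurable borel" for M
    unfolding f_def j_def by measurable
  have fin: "integral\<^sup>N lborel (f M) < \<infinity>" "integral\<^sup>N lborel (j M) < \<infinity>" if "0 \<le> M" for M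
    using dist_to_ends_powr_finite[OF \<open>s < 1\<close> that] that by (simp_all add: f_def[abs_def] j_def[abs_def])
  have "(\<integral>\<^sup>+y\<in>- K. riesz (2 + s) (x - y) \<partial>lebesgue) * indicator K x
      \<le> T * (f 1 (fst x) * j N (snd x) + j 1 (fst x) * f N (snd x))" for x
  proof (cases "x \<in> K")
    case True
    obtain a b where x: "x = (a, b)" by (cases x)
    have ab: "\<bar>a\<bar> < 1" "\<bar>b\<bar> < N" using True by (auto simp: x K_def)
    define d where "d = min (1 - \<bar>a\<bar>) (N - \<bar>b\<bar>)"
    have "d > 0" using ab by (simp add: d_def)
    have dist: "d \<le> norm (x - y)" if "y \<notin> K" for y
    proof -
      have "1 \<le> \<bar>fst y\<bar> \<or> N \<le> \<bar>snd y\<bar>" using that by (cases y) (auto simp: K_def)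
      then have "d \<le> \<bar>fst (x - y)\<bar> \<or> d \<le> \<bar>snd (x - y)\<bar>"
        unfolding d_def x by (auto simp: abs_if min_def split: if_splits)
      moreover have "\<bar>fst (x - y)\<bar> \<le> norm (x - y)" "\<bar>snd (x - y)\<bar> \<le> norm (x - y)"
        using norm_fst_le[of "fst (x - y)" "snd (x - y)"] norm_snd_le[of "snd (x - y)" "fst (x - y)"]
        unfolding prod.collapse real_norm_def .
      ultimately show ?thesis by linarith
    qed
    have "(\<integral>\<^sup>+y\<in>- K. riesz (2 + s) (x - y) \<partial>lebesgue)
        \<le> (\<integral>\<^sup>+y. riesz (2 + s) (x - y) * indicator {z. d \<le> norm z} (x - y) \<partial>lborel)"
      unfolding nn_integral_completion
      using dist by (intro nn_integral_mono) (auto split: split_indicator)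
    also have "\<dots> = (\<integral>\<^sup>+z\<in>{z. d \<le> norm z}. riesz (2 + s) (z :: real \<times> real) \<partial>lborel)"
      using nn_integral_lborel_shift[of "\<lambda>y. riesz (2 + s) (x - y) * indicator {z. d \<le> norm z} (x - y)" x]
      by (simp add: riesz_minus(1) indicator_def)
    also have "\<dots> = ennreal (d powr - s) * T"
      unfolding T_def by (rule riesz_tail_scale[OF \<open>d > 0\<close>])
    also have "\<dots> \<le> ennreal ((1 - \<bar>a\<bar>) powr - s + (N - \<bar>b\<bar>) powr - s) * T"
      by (intro mult_right_mono ennreal_leI) (auto simp: d_def min_def)
    finally show ?thesis
      using True ab by (simp add: x f_def j_def mult.commute abs_less_iff minus_less_iff)
  qed simp
  then have "interaction s K (- K) \<le> (\<integral>\<^sup>+x. T * (f 1 (fst x) * j N (snd x) + j 1 (fst x) * f N (snd x)) \<partial>lborel)"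
    unfolding interaction_eq_energy energy_def nn_integral_completion
    by (intro nn_integral_mono)
  also have "\<dots> = (\<integral>\<^sup>+a. \<integral>\<^sup>+b. T * (f 1 a * j N b + j 1 a * f N b) \<partial>lborel \<partial>lborel)"
    unfolding lborel_prod[symmetric] by (subst lborel.nn_integral_fst[symmetric]) simp_all
  also have "\<dots> = T * (integral\<^sup>N lborel (f 1) * integral\<^sup>N lborel (j N) + integral\<^sup>N lborel (j 1) * integral\<^sup>N lborel (f N))"
    by (simp add: nn_integral_cmult nn_integral_multc nn_integral_add)
  also have "\<dots> < \<infinity>"
    using fin[of 1] fin[OF \<open>0 \<le> N\<close>] riesz_tail_finite[of s 1] \<open>0 < s\<close>
    by (simp add: T_def ennreal_mult_less_top)
  finally show ?thesis .
qed

section \<open>The half-stadium\<close>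

definition cap :: "real \<Rightarrow> (real \<Rightarrow> real) \<Rightarrow> real \<Rightarrow> real" where
  "cap h v x = (if x \<in> {-1<..<1} then h + sqrt (1 - x\<^sup>2) else v x)"

text \<open>Used with \<open>(t, w)\<close> measured from the centre of the disk tangent to a leaf:
  points beside the strip or on or above the leaf avoid the open disk.\<close>

lemma outside_disk:
  fixes t w :: real
  assumes "t \<notin> {-1<..<1} \<or> sqrt (1 - t\<^sup>2) \<le> w"
  shows "1 \<le> t\<^sup>2 + w\<^sup>2"
  using assms
proof
  assume "t \<notin> {-1<..<1}"
  then have "1 \<le> t\<^sup>2" using abs_square_less_1[of t] by (auto simp: not_less[symmetric] abs_less_iff)
  then show ?thesis using zero_le_power2[of w] by linarith
next
  assume w: "sqrt (1 - t\<^sup>2) \<le> w"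
  show ?thesis
  proof (cases "t\<^sup>2 \<le> 1")
    case True
    then have "1 - t\<^sup>2 \<le> w\<^sup>2" using power_mono[OF w, of 2] by simp
    then show ?thesis by simp
  next
    case False
    then show ?thesis using zero_le_power2[of w] by linarith
  qed
qed

text \<open>Strict concavity of the unit arc: a point on the arc is not the midpoint of a
  nondegenerate segment whose ends lie on or below it. The hypotheses add up to
  \<open>2 * r \<le> w1 + w2\<close>; multiplying by \<open>r\<close> and completing squares leaves
  \<open>c^2 \<le> 0\<close>.\<close>

lemma sqrt_chord_degenerate:
  fixes a c d :: real
  assumes "a\<^sup>2 \<le> 1" "(a + c)\<^sup>2 \<le> 1" "(a - c)\<^sup>2 \<le> 1"
    and "sqrt (1 - a\<^sup>2) + d \<le> sqrt (1 - (a + c)\<^sup>2)" "sqrt (1 - a\<^sup>2) - d \<le> sqrt (1 - (a - c)\<^sup>2)"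
  shows "c = 0 \<and> d = 0"
proof -
  define r w1 w2 where defs: "r = sqrt (1 - a\<^sup>2)" "w1 = sqrt (1 - (a + c)\<^sup>2)" "w2 = sqrt (1 - (a - c)\<^sup>2)"
  have sq: "r\<^sup>2 = 1 - a\<^sup>2" "w1\<^sup>2 = 1 - (a + c)\<^sup>2" "w2\<^sup>2 = 1 - (a - c)\<^sup>2" "0 \<le> r"
    using assms by (auto simp: defs)
  have "r * (2 * r) \<le> r * (w1 + w2)"
    using assms(4,5) sq(4) by (intro mult_left_mono) (auto simp: defs)
  moreover have "2 * (r * (w1 + w2)) = 2 * r\<^sup>2 + w1\<^sup>2 + w2\<^sup>2 - (r - w1)\<^sup>2 - (r - w2)\<^sup>2"
    by (simp add: power2_eq_square algebra_simps)
  moreover have "2 * r\<^sup>2 + w1\<^sup>2 + w2\<^sup>2 = 4 * r\<^sup>2 - 2 * c\<^sup>2"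
    unfolding sq by (simp add: power2_eq_square algebra_simps)
  moreover have "r * (2 * r) = 2 * r\<^sup>2" by (simp add: power2_eq_square)
  ultimately have "c\<^sup>2 \<le> 0"
    using zero_le_power2[of "r - w1"] zero_le_power2[of "r - w2"] by linarith
  then have "c = 0" by simp
  then show ?thesis using assms(4,5) by simp
qed

lemma norm_unit_add_ge_imp_near_line:
  assumes "norm q = 1" "1 \<le> norm (q + z)" "1 \<le> norm (q - z)"
  shows "z \<in> near_line q"
proof -
  have "1 \<le> (norm (q + z))\<^sup>2" "1 \<le> (norm (q - z))\<^sup>2"
    using assms(2,3) by simp_all
  moreover have "(norm (q + z))\<^sup>2 = (norm q)\<^sup>2 + 2 * (z \<bullet> q) + (norm z)\<^sup>2"
    "(norm (q - z))\<^sup>2 = (norm q)\<^sup>2 - 2 * (z \<bullet> q) + (norm z)\<^sup>2"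
    by (simp_all add: power2_norm_eq_inner inner_simps inner_commute)
  moreover have "(norm q)\<^sup>2 = 1" using assms(1) by simp
  ultimately have "2 * \<bar>z \<bullet> q\<bar> \<le> (norm z)\<^sup>2" by linarith
  then show ?thesis by (simp add: near_line_def)
qed

section \<open>Calibration of the set below the arc\<close>

context
  fixes v :: "real \<Rightarrow> real" and M h s :: real and C :: ennreal and E :: "(real \<times> real) set"
  assumes v: "continuous_on UNIV v" and v_le: "\<And>t. t \<in> {-2..2} \<Longrightarrow> v t \<le> M"
    and h: "h = M + 1" and E: "E = subgraph (cap h v)" and s: "0 < s" "s < 1"
    and C: "\<And>q. norm q = 1 \<Longrightarrow> (\<integral>\<^sup>+z\<in>near_line q. riesz (2 + s) z \<partial>lborel) \<le> C"
begin

text \<open>The leaf parameter of the foliation: inside the strip its level sets are the vertical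
  translates of the arc, and it is the vertical distance below the boundary of \<open>E\<close>,
  counted negative above it.\<close>

definition depth :: "real \<times> real \<Rightarrow> real" where
  "depth x = h + sqrt (1 - (fst x)\<^sup>2) - snd x"

lemma depth_measurable[measurable]: "depth \<in> borel \<Otimes>\<^sub>M borel \<rightarrow>\<^sub>M borel"
  unfolding depth_def by measurable

lemma strip_measurable[measurable]: "strip \<in> sets (borel \<Otimes>\<^sub>M borel)"
  unfolding strip_def by (intro pair_measureI) auto

lemma v_measurable[measurable]: "v \<in> borel_measurable borel"
  using v by (rule borel_measurable_continuous_onI)

lemma mem_E: "x \<in> E \<longleftrightarrow> (if x \<in> strip then 0 < depth x else snd x < v (fst x))"
  by (cases x) (auto simp: E subgraph_def cap_def strip_def depth_def)

lemma E_borel_pair[measurable]: "E \<in> sets (borel \<Otimes>\<^sub>M borel)"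
proof -
  have "E = {x \<in> space (borel \<Otimes>\<^sub>M borel). if x \<in> strip then 0 < depth x else snd x < v (fst x)}"
    using mem_E by (auto simp: space_pair_measure)
  also have "\<dots> \<in> sets (borel \<Otimes>\<^sub>M borel)"
    by measurable
  finally show ?thesis .
qed

lemma E_lebesgue: "E \<in> sets lebesgue"
proof -
  have "E \<in> sets borel" using E_borel_pair unfolding borel_prod .
  then show ?thesis by simp
qed

text \<open>Here \<open>W\<close> is the outside of the half-stadium below the leaf through
  \<open>x\<close>, including everything beside the strip. It avoids the open unit disk touching the
  leaf at \<open>x\<close> from inside, so a reflected pair in \<open>W\<close> satisfies the
  \<open>near_line\<close> condition.\<close>

lemma interaction_removed_le:
  assumes "A \<in> sets lebesgue" "A \<subseteq> E" "A \<subseteq> strip" "emeasure lebesgue A < \<infinity>"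
  shows "interaction s A (- E) \<le> interaction s A (E - A) + C * emeasure lebesgue A"
  unfolding interaction_eq_energy
proof (rule riesz_energy_compl_le[where W = "{z. snd z \<notin> strip \<or> depth (snd z) \<le> depth (fst z)}"])
  have "{z \<in> space ((borel \<Otimes>\<^sub>M borel) \<Otimes>\<^sub>M (borel \<Otimes>\<^sub>M borel)). snd z \<notin> strip \<or> depth (snd z) \<le> depth (fst z)}
      \<in> sets ((borel \<Otimes>\<^sub>M borel) \<Otimes>\<^sub>M (borel \<Otimes>\<^sub>M borel))"
    by measurable
  then show "{z. snd z \<notin> strip \<or> depth (snd z) \<le> depth (fst z)} \<in> sets borel"
    unfolding borel_prod by simp
next
  fix x assume "x \<in> A"
  obtain a b where x: "x = (a, b)" by (cases x)
  define r where "r = sqrt (1 - a\<^sup>2)"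
  have "a \<in> {-1<..<1}" using \<open>x \<in> A\<close> \<open>A \<subseteq> strip\<close> by (auto simp: x strip_def)
  then have "a\<^sup>2 \<le> 1" by (auto simp: abs_square_le_1 abs_le_iff)
  \<comment> \<open>The touching disk has centre \<open>(0, b - r)\<close>, and
    \<open>(a, r)\<close> is the vector from this centre to \<open>x\<close>.\<close>
  then have "norm (a, r) = 1" by (simp add: norm_Pair r_def)
  moreover have far: "1 \<le> norm ((a, r) + z)"
    if "snd (x, x + z) \<notin> strip \<or> depth (snd (x, x + z)) \<le> depth (fst (x, x + z))" for z
  proof -
    have "1 \<le> (a + fst z)\<^sup>2 + (r + snd z)\<^sup>2"
      using that by (intro outside_disk) (cases z; auto simp: x strip_def depth_def r_def)
    then show ?thesis by (cases z) (simp add: norm_Pair)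
  qed
  ultimately show "\<exists>q. norm q = 1 \<and> (\<forall>z. z \<noteq> 0 \<longrightarrow>
      (x, x + z) \<in> {z. snd z \<notin> strip \<or> depth (snd z) \<le> depth (fst z)} \<longrightarrow>
      (x, x - z) \<in> {z. snd z \<notin> strip \<or> depth (snd z) \<le> depth (fst z)} \<longrightarrow> z \<in> near_line q)"
    using far[of "- z" for z]
    by (intro exI[of _ "(a, r)"]) (auto intro!: norm_unit_add_ge_imp_near_line)
next
  fix x y assume "x \<in> A" "y \<notin> E"
  then show "(x, y) \<in> {z. snd z \<notin> strip \<or> depth (snd z) \<le> depth (fst z)}"
    using assms mem_E[of x] mem_E[of y] by auto
qed (use assms s C E_lebesgue in auto)

text \<open>The same scheme with \<open>- E\<close> in place of \<open>E\<close>. Beside the strip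
  \<open>W\<close> is \<open>E\<close> itself, whose points stay away from \<open>x\<close>; inside,
  it is the convex region below the leaf, which contains no short reflected pair around its boundary
  point \<open>x\<close>.\<close>

lemma interaction_added_le:
  assumes "B \<in> sets lebesgue" "B \<inter> E = {}" "B \<subseteq> strip" "emeasure lebesgue B < \<infinity>"
  shows "interaction s B E \<le> interaction s B (- E - B) + C * emeasure lebesgue B"
proof -
  define W where "W = {z. if snd z \<in> strip then depth (fst z) \<le> depth (snd z) else snd z \<in> E}"
  have "energy (\<lambda>x y. riesz (2 + s) (x - y)) B (- (- E))
      \<le> energy (\<lambda>x y. riesz (2 + s) (x - y)) B (- E - B) + C * emeasure lebesgue B"
  proof (rule riesz_energy_compl_le[where W = W])
    have "{z \<in> space ((borel \<Otimes>\<^sub>M borel) \<Otimes>\<^sub>M (borel \<Otimes>\<^sub>M borel)). if snd z \<in> strip then depth (fst z) \<le> depth (snd z) else snd z \<in> E}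
      \<in> sets ((borel \<Otimes>\<^sub>M borel) \<Otimes>\<^sub>M (borel \<Otimes>\<^sub>M borel))"
      by measurable
    then show "W \<in> sets borel"
      unfolding borel_prod W_def by simp
  next
    fix x assume "x \<in> B"
    obtain a b where x: "x = (a, b)" by (cases x)
    have a: "a \<in> {-1<..<1}" and b: "h + sqrt (1 - a\<^sup>2) \<le> b"
      using \<open>x \<in> B\<close> assms(2,3) mem_E[of x] by (auto simp: x strip_def depth_def)
    have "a\<^sup>2 \<le> 1" using a by (auto simp: abs_square_le_1 abs_le_iff)
    then have "h \<le> b" using b real_sqrt_ge_zero[of "1 - a\<^sup>2"] by linarith
    have chord: "a + fst z \<in> {-1<..<1} \<and> sqrt (1 - a\<^sup>2) + snd z \<le> sqrt (1 - (a + fst z)\<^sup>2)"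
      if z: "(x, x + z) \<in> W" "norm z < 1 / 2" for z
    proof -
      obtain c d where cd: "z = (c, d)" by (cases z)
      have "\<bar>c\<bar> < 1 / 2" "\<bar>d\<bar> < 1 / 2"
        using z(2) norm_fst_le[of c d] norm_snd_le[of d c] by (auto simp: cd)
      \<comment> \<open>The abscissa lies in [-2, 2]. As the height of \<open>x + z\<close> exceeds
        \<open>h - 1 / 2\<close>, which is above \<open>M\<close>, the point cannot belong to
        \<open>E\<close> beside the strip.\<close>
      then have "v (a + c) \<le> M" using a by (intro v_le) auto
      then have "x + z \<in> strip"
        using z(1) mem_E[of "x + z"] \<open>h \<le> b\<close> \<open>\<bar>d\<bar> < 1 / 2\<close> h
        by (auto simp: W_def x cd split: if_splits)
      then show ?thesis using z(1) by (auto simp: W_def x cd strip_def depth_def)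
    qed
    \<comment> \<open>Only \<open>norm z \<ge> 1 / 2\<close> is established, which puts
      \<open>z\<close> in \<open>near_line q\<close> for any \<open>q\<close>; the vector (1, 0) is
      an arbitrary unit vector.\<close>
    have "z \<in> near_line (1, 0)" if z: "z \<noteq> 0" "(x, x + z) \<in> W" "(x, x - z) \<in> W" for z
    proof (rule ccontr)
      assume "z \<notin> near_line (1, 0)"
      then have small: "norm z < 1 / 2" by (simp add: near_line_def)
      have 1: "a + fst z \<in> {-1<..<1}" "sqrt (1 - a\<^sup>2) + snd z \<le> sqrt (1 - (a + fst z)\<^sup>2)"
        using chord[OF z(2) small] by auto
      have 2: "a - fst z \<in> {-1<..<1}" "sqrt (1 - a\<^sup>2) - snd z \<le> sqrt (1 - (a - fst z)\<^sup>2)"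
        using chord[of "- z"] z(3) small by auto
      have "fst z = 0 \<and> snd z = 0"
        using 1 2 by (intro sqrt_chord_degenerate[OF \<open>a\<^sup>2 \<le> 1\<close>]) (auto simp: abs_square_le_1 abs_le_iff)
      then show False using \<open>z \<noteq> 0\<close> by (simp add: prod_eq_iff)
    qed
    then show "\<exists>q. norm q = 1 \<and> (\<forall>z. z \<noteq> 0 \<longrightarrow> (x, x + z) \<in> W \<longrightarrow> (x, x - z) \<in> W \<longrightarrow> z \<in> near_line q)"
      by (intro exI[of _ "(1, 0)"]) (simp add: norm_Pair)
  next
    fix x y assume "x \<in> B" "y \<notin> - E"
    then show "(x, y) \<in> W"
      using assms mem_E[of x] mem_E[of y] by (auto simp: W_def)
  qed (use assms s C E_lebesgue in \<open>auto simp: W_def Compl_in_sets_lebesgue\<close>)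
  then show ?thesis by (simp add: interaction_eq_energy)
qed

lemma Per_E_le:
  assumes [measurable]: "F \<in> sets lebesgue" "K \<in> sets lebesgue"
    and "bounded K" "K \<subseteq> strip" "sym_diff E F \<subseteq> K"
  shows "Per s E K \<le> Per s F K + C * emeasure lebesgue (sym_diff E F)"
proof -
  note [measurable] = E_lebesgue
  have fin: "emeasure lebesgue X < \<infinity>" if "X \<subseteq> sym_diff E F" for X
  proof -
    have "emeasure lebesgue X \<le> emeasure lebesgue K"
      using that assms by (intro emeasure_mono) auto
    then show ?thesis
      using bounded_set_imp_lmeasurable[OF \<open>bounded K\<close> assms(2)] by (auto simp: fmeasurable_def)
  qed
  show ?thesis
  proof (rule Per_le_if_one_sided)
    show "interaction s (E - F) (- E) \<le> interaction s (E - F) (E \<inter> F) + C * emeasure lebesgue (E - F)"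
      using interaction_removed_le[of "E - F"] fin[of "E - F"] assms by (auto simp: Diff_Diff_Int)
    show "interaction s (F - E) E \<le> interaction s (F - E) (- (E \<union> F)) + C * emeasure lebesgue (F - E)"
    proof -
      have "- E - (F - E) = - (E \<union> F)" by auto
      then show ?thesis
        using interaction_added_le[of "F - E"] fin[of "F - E"] assms by auto
    qed
  qed (use assms in auto)
qed

text \<open>There is no circularity: \<open>Per_E_le\<close> holds without knowing that the left
  side is finite. Emptying \<open>E\<close> inside a box containing \<open>K\<close> gives a
  competitor with perimeter at most that of the box.\<close>

lemma Per_E_finite:
  assumes "C < \<infinity>" "K \<in> sets lebesgue" "bounded K" "K \<subseteq> strip"
  shows "Per s E K < \<infinity>"
proof -
  note [measurable] = E_lebesgue
  obtain N where "N > 0" and N: "\<And>x. x \<in> K \<Longrightarrow> norm x \<le> N"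
    using \<open>bounded K\<close> by (auto simp: bounded_pos)
  define Q where "Q = {-1<..<1::real} \<times> {-(N + 1)<..<N + 1}"
  have "open Q" "bounded Q" unfolding Q_def by (auto intro: open_Times bounded_Times)
  then have [measurable]: "Q \<in> sets lebesgue" by auto
  have "Q \<subseteq> strip" by (auto simp: Q_def strip_def)
  have "K \<subseteq> Q"
  proof
    fix x assume "x \<in> K"
    then show "x \<in> Q"
      using N[of x] norm_snd_le[of "snd x" "fst x"] \<open>K \<subseteq> strip\<close>
      by (cases x) (auto simp: Q_def strip_def)
  qed
  have "Per s E K \<le> Per s E Q"
    using assms \<open>K \<subseteq> Q\<close> E_lebesgue by (intro Per_mono) auto
  also have "\<dots> \<le> Per s (E - Q) Q + C * emeasure lebesgue (sym_diff E (E - Q))"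
    using \<open>bounded Q\<close> \<open>Q \<subseteq> strip\<close> by (intro Per_E_le) auto
  also have "Per s (E - Q) Q \<le> interaction s {} UNIV + interaction s (- Q) Q"
    unfolding Per_def by (intro add_mono interaction_mono) auto
  also have "interaction s {} UNIV = 0" by (simp add: interaction_def)
  also have "interaction s (- Q) Q = interaction s Q (- Q)"
    by (rule interaction_commute) (auto simp: Compl_in_sets_lebesgue)
  finally have "Per s E K \<le> interaction s Q (- Q) + C * emeasure lebesgue (sym_diff E (E - Q))"
    by (simp add: add_right_mono)
  moreover have "emeasure lebesgue (sym_diff E (E - Q)) \<le> emeasure lebesgue Q"
    by (intro emeasure_mono) auto
  moreover have "emeasure lebesgue Q < \<infinity>"
    using bounded_set_imp_lmeasurable[OF \<open>bounded Q\<close>] by (auto simp: fmeasurable_def)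
  moreover have "interaction s Q (- Q) < \<infinity>"
    unfolding Q_def using s \<open>N > 0\<close> by (intro interaction_box_finite) auto
  ultimately show ?thesis
    using \<open>C < \<infinity>\<close> by (auto simp: ennreal_mult_less_top order.strict_trans1)
qed

lemma almost_minimal_E:
  assumes "C < \<infinity>"
  shows "almost_minimal_in s E strip"
  unfolding almost_minimal_in_def minimal_in_def minimal_in_bounded_def
\<comment> \<open>\<open>C\<close> is finite, so \<open>enn2real\<close> loses nothing; it was fixed
  before \<open>K\<close>, so one constant serves all \<open>K\<close>.\<close>
proof (intro exI[of _ "enn2real C"] conjI allI impI ballI)
  fix K assume "bounded_lipschitz_open K \<and> K \<subseteq> strip"
  then have K: "K \<in> sets lebesgue" "bounded K" "K \<subseteq> strip"
    by (auto simp: bounded_lipschitz_open_def)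
  show "Per s E K < \<infinity>"
    using Per_E_finite[OF assms] K by blast
  fix F assume "F \<in> sets lebesgue" "sym_diff E F \<subseteq> K"
  then show "Per s E K \<le> Per s F K + ennreal (enn2real C) * emeasure lebesgue (sym_diff E F)"
    using Per_E_le[of F K] K assms by simp
qed (use E_lebesgue in auto)

end

theorem proposition6p1:
  fixes s \<alpha> :: real and v :: "real \<Rightarrow> real"
  assumes "0 < s" and "s < 1"
    and "0 < \<alpha>" and "\<alpha> < 1"
    and "C1_holder_on \<alpha> UNIV v"
    and "finite_perimeter_in s (subgraph v) strip"
  shows "\<exists>E. almost_minimal_in s E strip \<and>
           (\<exists>u :: real \<Rightarrow> real. E = subgraph u \<and>
              C1_holder_on \<alpha> {-1<..<1} u \<and>
              (\<forall>x. x \<notin> {-1<..<1} \<longrightarrow> u x = v x) \<and>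
              \<not> isCont u (-1) \<and> \<not> isCont u 1)"
proof -
  have v: "continuous_on UNIV v"
  proof -
    obtain v' where "(v has_real_derivative v' x) (at x)" for x
      using assms(5) unfolding C1_holder_on_def by auto
    then show ?thesis by (intro continuous_at_imp_continuous_on ballI DERIV_isCont)
  qed
  have "{-2..2::real} \<noteq> {}" by simp
  then obtain t0 where "\<forall>t\<in>{-2..2}. v t \<le> v t0"
    using continuous_attains_sup[OF compact_Icc _ continuous_on_subset[OF v]] by blast
  then obtain M where v_le: "\<And>t. t \<in> {-2..2} \<Longrightarrow> v t \<le> M" by blast
  obtain C :: ennreal where C: "C < \<infinity>"
    "\<And>q. norm q = 1 \<Longrightarrow> (\<integral>\<^sup>+z\<in>near_line q. riesz (2 + s) z \<partial>lborel) \<le> C"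
    using near_line_bound[OF assms(1,2)] by blast
  define u where "u = cap (M + 1) v"
  have "almost_minimal_in s (subgraph u) strip"
    unfolding u_def by (rule almost_minimal_E[OF v v_le refl refl assms(1,2) C(2,1)])
  moreover have "C1_holder_on \<alpha> {-1<..<1} u"
  proof -
    obtain f' where f': "\<And>x. x \<in> {-1<..<1} \<Longrightarrow> ((\<lambda>x. (M + 1) + sqrt (1 - x\<^sup>2)) has_real_derivative f' x) (at x)"
      and holder: "\<And>C. compact C \<and> C \<subseteq> {-1<..<1} \<Longrightarrow> \<exists>M. \<forall>x\<in>C. \<forall>y\<in>C. \<bar>f' x - f' y\<bar> \<le> M * \<bar>x - y\<bar> powr \<alpha>"
      using semicircle_C1_holder[OF \<open>\<alpha> < 1\<close>, of "M + 1"] unfolding C1_holder_on_def by metis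
    \<comment> \<open>\<open>u\<close> equals the arc function only on the open interval, which
      suffices because differentiability is local.\<close>
    have "(u has_real_derivative f' x) (at x)" if "x \<in> {-1<..<1}" for x
      by (rule has_field_derivative_transform_within_open[OF f'[OF that] open_greaterThanLessThan that])
         (simp add: u_def cap_def)
    then show ?thesis
      unfolding C1_holder_on_def using holder by blast
  qed
  moreover have "\<not> isCont u a" if a: "a = -1 \<or> a = 1" for a
  proof (rule not_isCont_if_one_sided_limit)
    show "a \<in> closure {-1<..<1::real}" "a \<notin> {-1<..<1}" using a by auto
    show "u x = (\<lambda>x. M + 1 + sqrt (1 - x\<^sup>2)) x" if "x \<in> {-1<..<1}" for x
      using that by (simp add: u_def cap_def)
    show "isCont (\<lambda>x. M + 1 + sqrt (1 - x\<^sup>2)) a"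
      by (intro continuous_intros)
    \<comment> \<open>At the endpoints the root vanishes, so the limit from inside is
      \<open>M + 1\<close>, whereas \<open>u a = v a \<le> M\<close>.\<close>
    show "u a \<noteq> M + 1 + sqrt (1 - a\<^sup>2)"
      using a v_le[of a] by (auto simp: u_def cap_def)
  qed
  ultimately show ?thesis
    by (intro exI[of _ "subgraph u"] conjI exI[of _ u]) (auto simp: u_def cap_def)
qed

end
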